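(* Let $\kappa,\lambda,\mu,\nu\in\mathbb{R}$ be pairwise distinct and $\mathfrak{p}=\{(\kappa,1),(\lambda,1),(\mu,2),(\nu,3)\}$. Then the set of all block diagonal matrices $$\operatorname{diag}(\nu\mathbb{I}_2,A,B),\qquad A=R_\alpha^{-1}\begin{pmatrix}\nu&0\\0&\mu\end{pmatrix}R_\alpha,\quad B=S_{\theta,\phi}^{-1}\begin{pmatrix}\mu&0&0\\0&\lambda&0\\0&0&\kappa\end{pmatrix}S_{\theta,\phi},$$ with $$(\alpha,\theta,\phi)\in\left(\left]0,\tfrac{\pi}{2}\right]\times\left[0,\tfrac{\pi}{2}\right]\times\left]0,\tfrac{\pi}{2}\right]\right)\cup\left(\left]0,\tfrac{\pi}{2}\right]\times\{(0,0)\}\right)\cup\{(0,0,0)\},$$ is a cross-section for $\mathrm{Sym}_{\mathfrak{p}}/\mathcal{G}_2$.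
   Context: $R_\alpha=\begin{pmatrix}\cos\alpha&-\sin\alpha\\ \sin\alpha&\cos\alpha\end{pmatrix}$ and $S_{\alpha,\beta}=\begin{pmatrix}\cos\alpha&-\cos\beta\sin\alpha&\sin\beta\sin\alpha\\ \sin\alpha&\cos\beta\cos\alpha&-\sin\beta\cos\alpha\\0&\sin\beta&\cos\beta\end{pmatrix}$; $\operatorname{diag}(\cdot)$ denotes the block diagonal matrix with the listed blocks; $]a,b]$ denotes a half-open interval. Let $V$ be a 7-dimensional Euclidean space with a vector product $\pi$, i.e. a linear map $\pi:V\wedge V\to V$ such that $\{u,v,\pi(u\wedge v)\}$ is orthonormal whenever $\{u,v\}\subset V$ is. Write $xy=\pi(x\wedge y)$. Let $\mathcal{G}_2=\mathrm{Aut}(\pi)$ be the group of all orthogonal linear maps $g:V\to V$ with $g(xy)=g(x)g(y)$ for all $x,y\in V$. A Cayley triple is a triple $(u,v,z)\in V^3$ such that $\{u,v,uv,z\}$ is orthonormal; it determines an orthonormal basis $(u,v,uv,z,uz,vz,(uv)z)$ of $V$. Fix a Cayley triple $s$, and for a symmetric endomorphism $\delta$ of $V$ let $[\delta]_s$ be its matrix in the basis determined by $s$; $\delta\mapsto[\delta]_s$ is a bijection $\mathrm{Sym}(V)\to\mathrm{Sym}(\mathbb{R}^7)$ from symmetric endomorphisms of $V$ to real symmetric $7\times7$-matrices. $\mathcal{G}_2$ acts on $\mathrm{Sym}(\mathbb{R}^7)$ by $[\delta]_s\cdot g=[g^{-1}\delta g]_s$. For a symmetric matrix $\delta$ let $\mathfrak{p}(\delta)=\{(\lambda,\dim\mathcal{E}_\lambda(\delta))\mid\lambda\text{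 an eigenvalue of }\delta\}$, where $\mathcal{E}_\lambda(\delta)$ is the eigenspace of $\lambda$, and for a set $\mathfrak{p}$ of such pairs let $\mathrm{Sym}_{\mathfrak{p}}=\{\delta\in\mathrm{Sym}(\mathbb{R}^7)\mid\mathfrak{p}(\delta)=\mathfrak{p}\}$, which is invariant under the action. A cross-section for $\mathrm{Sym}_{\mathfrak{p}}/\mathcal{G}_2$ is a subset of $\mathrm{Sym}_{\mathfrak{p}}$ containing exactly one element of each $\mathcal{G}_2$-orbit. $\mathbb{I}_n$ is the $n\times n$ identity matrix. *)

theory Defs
  imports "HOL-Analysis.Analysis"
begin

text \<open>Orthonormality of a family, given as a list: distinctness excludes repeated members.\<close>

definition orthonormal :: "'v::euclidean_space list \<Rightarrow> bool" where
  "orthonormal xs \<longleftrightarrow>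
     distinct xs \<and> pairwise orthogonal (set xs) \<and> (\<forall>x\<in>set xs. norm x = 1)"

text \<open>A linear map on the exterior square of the space is the same as an alternating bilinear map.\<close>

definition vector_product :: "('v::euclidean_space \<Rightarrow> 'v \<Rightarrow> 'v) \<Rightarrow> bool" where
  "vector_product \<pi> \<longleftrightarrow>
     bilinear \<pi> \<and> (\<forall>x. \<pi> x x = 0) \<and>
     (\<forall>u v. orthonormal [u, v] \<longrightarrow> orthonormal [u, v, \<pi> u v])"

definition aut_vp :: "('v::euclidean_space \<Rightarrow> 'v \<Rightarrow> 'v) \<Rightarrow> ('v \<Rightarrow> 'v) set" where
  "aut_vp \<pi> = {g. orthogonal_transformation g \<and> (\<forall>x y. g (\<pi> x y) = \<pi> (g x) (g y))}"

definition cayley_triple ::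
    "('v::euclidean_space \<Rightarrow> 'v \<Rightarrow> 'v) \<Rightarrow> 'v \<times> 'v \<times> 'v \<Rightarrow> bool" where
  "cayley_triple \<pi> = (\<lambda>(u, v, z). orthonormal [u, v, \<pi> u v, z])"

definition cayley_basis ::
    "('v::euclidean_space \<Rightarrow> 'v \<Rightarrow> 'v) \<Rightarrow> 'v \<times> 'v \<times> 'v \<Rightarrow> 'v^7" where
  "cayley_basis \<pi> = (\<lambda>(u, v, z).
     vector [u, v, \<pi> u v, z, \<pi> u z, \<pi> v z, \<pi> (\<pi> u v) z])"

definition sym_endo :: "('v::euclidean_space \<Rightarrow> 'v) set" where
  "sym_endo = {\<delta>. linear \<delta> \<and> (\<forall>x y. \<delta> x \<bullet> y = x \<bullet> \<delta> y)}"

definition sym_mat :: "(real^'n^'n) set" where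
  "sym_mat = {M. transpose M = M}"

text \<open>Column \<open>j\<close> consists of the coordinates of the image of the \<open>j\<close>-th basis vector.\<close>

definition matrix_wrt :: "'v::euclidean_space^'n \<Rightarrow> ('v \<Rightarrow> 'v) \<Rightarrow> real^'n^'n" where
  "matrix_wrt b \<delta> =
     (\<chi> i j. representation (range (\<lambda>k. b $ k)) (\<delta> (b $ j)) (b $ i))"

text \<open>The action transported along the bijection from symmetric endomorphisms to symmetric
  matrices; it is meaningful only for symmetric \<open>M\<close> and a Cayley triple \<open>s\<close>.\<close>

definition mat_act ::
    "('v::euclidean_space \<Rightarrow> 'v \<Rightarrow> 'v) \<Rightarrow> 'v \<times> 'v \<times> 'v \<Rightarrow> real^7^7 \<Rightarrow> ('v \<Rightarrow> 'v) \<Rightarrow> real^7^7" where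
  "mat_act \<pi> s M g =
     (let \<delta> = the_inv_into sym_endo (matrix_wrt (cayley_basis \<pi> s)) M
      in matrix_wrt (cayley_basis \<pi> s) (inv g \<circ> \<delta> \<circ> g))"

definition mat_orbit ::
    "('v::euclidean_space \<Rightarrow> 'v \<Rightarrow> 'v) \<Rightarrow> 'v \<times> 'v \<times> 'v \<Rightarrow> real^7^7 \<Rightarrow> (real^7^7) set" where
  "mat_orbit \<pi> s M = mat_act \<pi> s M ` aut_vp \<pi>"

definition eigenspace :: "real^'n^'n \<Rightarrow> real \<Rightarrow> (real^'n) set" where
  "eigenspace M l = {x. M *v x = l *\<^sub>R x}"

definition spectral_data :: "real^'n^'n \<Rightarrow> (real \<times> nat) set" where
  "spectral_data M = {(l, dim (eigenspace M l)) | l. \<exists>x. x \<noteq> 0 \<and> M *v x = l *\<^sub>R x}"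

definition sym_mat_of :: "(real \<times> nat) set \<Rightarrow> (real^'n^'n) set" where
  "sym_mat_of p = {M \<in> sym_mat. spectral_data M = p}"

text \<open>The last two arguments are the invariant set being divided by the action and the candidate
  set of representatives.\<close>

definition cross_section ::
    "('v::euclidean_space \<Rightarrow> 'v \<Rightarrow> 'v) \<Rightarrow> 'v \<times> 'v \<times> 'v \<Rightarrow> (real^7^7) set \<Rightarrow> (real^7^7) set \<Rightarrow> bool" where
  "cross_section \<pi> s X C \<longleftrightarrow>
     C \<subseteq> X \<and> (\<forall>M\<in>X. \<exists>!N. N \<in> C \<and> N \<in> mat_orbit \<pi> s M)"

definition Rot :: "real \<Rightarrow> real^2^2" where
  "Rot \<alpha> = vector [vector [cos \<alpha>, - sin \<alpha>],
                   vector [sin \<alpha>,   cos \<alpha>]]"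

definition SRot :: "real \<Rightarrow> real \<Rightarrow> real^3^3" where
  "SRot \<alpha> \<beta> = vector [vector [cos \<alpha>, - cos \<beta> * sin \<alpha>,   sin \<beta> * sin \<alpha>],
                      vector [sin \<alpha>,   cos \<beta> * cos \<alpha>, - sin \<beta> * cos \<alpha>],
                      vector [0,       sin \<beta>,           cos \<beta>]]"

definition diag2 :: "real \<Rightarrow> real \<Rightarrow> real^2^2" where
  "diag2 a b = vector [vector [a, 0], vector [0, b]]"

definition diag3 :: "real \<Rightarrow> real \<Rightarrow> real \<Rightarrow> real^3^3" where
  "diag3 a b c = vector [vector [a, 0, 0], vector [0, b, 0], vector [0, 0, c]]"

definition block_diag :: "real^2^2 \<Rightarrow> real^2^2 \<Rightarrow> real^3^3 \<Rightarrow> real^7^7" where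
  "block_diag X A B = vector
    [vector [X$1$1, X$1$2, 0, 0, 0, 0, 0],
     vector [X$2$1, X$2$2, 0, 0, 0, 0, 0],
     vector [0, 0, A$1$1, A$1$2, 0, 0, 0],
     vector [0, 0, A$2$1, A$2$2, 0, 0, 0],
     vector [0, 0, 0, 0, B$1$1, B$1$2, B$1$3],
     vector [0, 0, 0, 0, B$2$1, B$2$2, B$2$3],
     vector [0, 0, 0, 0, B$3$1, B$3$2, B$3$3]]"

end

theory Submission
  imports Defs
begin

text \<open>
  Let \<delta> be a symmetric endomorphism with eigenvalues \<nu>, \<mu>, \<lambda>, \<kappa> of multiplicity 3, 2, 1, 1,
  and let N be its \<nu>-eigenspace. All Cayley triples have the same multiplication table, so the
  automorphisms of the vector product act transitively on them, and the orbit of the matrix of \<delta>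
  consists of the matrices of \<delta> in the bases of all Cayley triples (\<open>mat_orbit_eq\<close>). For a triple
  (u, v, z) put w = uv, f = wz, n = cos \<alpha> w - sin \<alpha> z and m = sin \<alpha> w + cos \<alpha> z. The matrix of
  \<delta> is the normal form with parameters \<alpha>, \<theta>, \<phi> iff the vectors u, v, n span N, the vector m and
  a vector m' belong to \<mu>, a vector l to \<lambda> and a vector k to \<kappa>, where m', l, k arise from
  uz, vz, f by the rotation with angles \<theta> and \<phi> (\<open>matrix_wrt_normal_form_iff\<close>). So exactly one
  parameter triple must admit such a Cayley triple.

  The key is the unit vector f. It is orthogonal to N and to all products of two vectors of N, and if
  sin \<alpha> is not 0 then this determines f up to sign (\<open>plane_normal_unique\<close>). Moreover uf = vz,
  vf = -uz and nf = -m (\<open>plane_normal_vprod\<close>), so multiplication by f identifies N with the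
  orthogonal complement of N and f.

  Existence. If N contains an orthonormal pair together with its product, take a unit \<mu>-eigenvector
  as z; multiplication by z maps N onto the complement of N and z, so u and v can be chosen such that
  uz and vz are eigenvectors for \<mu> and \<lambda>, and all three angles vanish
  (\<open>eigenframe_associative\<close>). Otherwise first choose a unit vector f orthogonal to N and its
  products. Two linear conditions on the three-dimensional space N leave room for a unit vector n
  with nf in the \<mu>-eigenspace, then for a unit vector v in N orthogonal to n with vf orthogonal to
  the \<kappa>-eigenspace, and u completes an orthonormal basis of N (\<open>eigenframe_nonassociative\<close>). The
  remaining rotation angles are brought into the first quadrant by replacing (u, v, z) with
  (\<epsilon>u, \<tau>v, \<epsilon>\<tau>z) for signs \<epsilon> and \<tau>, which leaves f fixed (\<open>eigenframe_adjust_signs\<close>).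

  Uniqueness. The number cos \<alpha> is the length of the projection to N of the product of any two
  orthonormal vectors of N. If \<alpha> is not 0, then f is known up to sign, so are l and k, and
  cos \<phi> and sin \<phi> cos \<theta> are the absolute values of the inner products of f with k and l
  (\<open>eigenframe_parameters_unique\<close>).
\<close>

section \<open>Vector products\<close>

locale cross_product =
  fixes vprod :: "'v::euclidean_space \<Rightarrow> 'v \<Rightarrow> 'v" (infixl "\<star>" 76)
  assumes vector_product: "vector_product (\<star>)"
begin

lemma vprod_bilinear: "bilinear (\<star>)"
  and vprod_self [simp]: "x \<star> x = 0"
  using vector_product by (auto simp: vector_product_def)

lemmas vprod_simps =
  bilinear_ladd [OF vprod_bilinear] bilinear_radd [OF vprod_bilinear]
  bilinear_lsub [OF vprod_bilinear] bilinear_rsub [OF vprod_bilinear]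
  bilinear_lmul [OF vprod_bilinear] bilinear_rmul [OF vprod_bilinear]
  bilinear_lneg [OF vprod_bilinear] bilinear_rneg [OF vprod_bilinear]
  bilinear_lzero [OF vprod_bilinear] bilinear_rzero [OF vprod_bilinear]

lemma vprod_anticommute: "x \<star> y = - (y \<star> x)"
proof -
  have "0 = (x + y) \<star> (x + y)" by (simp only: vprod_self)
  also have "\<dots> = x \<star> y + y \<star> x" by (simp add: vprod_simps del: vprod_self) simp
  finally show ?thesis by (simp add: eq_neg_iff_add_eq_0)
qed

lemma vprod_flip: "y \<star> x = - c \<Longrightarrow> x \<star> y = c"
  using vprod_anticommute[of x y] by simp

text \<open>The axiom speaks of orthonormal pairs; rescaling extends it to orthogonal ones.\<close>

lemma vprod_orthogonal_args:
  assumes "x \<bullet> y = 0"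
  shows "(x \<star> y) \<bullet> x = 0" and "(x \<star> y) \<bullet> (x \<star> y) = (x \<bullet> x) * (y \<bullet> y)"
proof -
  have "(x \<star> y) \<bullet> x = 0 \<and> (x \<star> y) \<bullet> (x \<star> y) = (x \<bullet> x) * (y \<bullet> y)"
  proof (cases "x = 0 \<or> y = 0")
    case True
    then show ?thesis by (auto simp: vprod_simps)
  next
    case False
    define u v where "u = x /\<^sub>R norm x" and "v = y /\<^sub>R norm y"
    have nz: "norm x \<noteq> 0" "norm y \<noteq> 0" using False by auto
    have x: "x = norm x *\<^sub>R u" and y: "y = norm y *\<^sub>R v"
      using nz by (simp_all add: u_def v_def)
    have uv: "norm u = 1" "norm v = 1" "u \<bullet> v = 0"
      using nz assms by (simp_all add: u_def v_def)
    then have "u \<noteq> v" by auto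
    then have "orthonormal [u, v]"
      using uv by (auto simp: orthonormal_def pairwise_def orthogonal_def inner_commute)
    then have "orthonormal [u, v, u \<star> v]"
      using vector_product by (auto simp: vector_product_def)
    then have o: "(u \<star> v) \<bullet> u = 0" "norm (u \<star> v) = 1"
      by (auto simp: orthonormal_def pairwise_def orthogonal_def)
    have xy: "x \<star> y = (norm x * norm y) *\<^sub>R (u \<star> v)"
      by (subst x, subst y) (simp add: vprod_simps)
    have "(x \<star> y) \<bullet> (norm x *\<^sub>R u) = 0"
      unfolding xy by (simp add: o)
    then have "(x \<star> y) \<bullet> x = 0"
      using x by simp
    moreover have "(x \<star> y) \<bullet> (x \<star> y) = (x \<bullet> x) * (y \<bullet> y)"
      unfolding xy using o
      by (simp add: dot_square_norm power2_eq_square norm_eq_1)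
    ultimately show ?thesis ..
  qed
  then show "(x \<star> y) \<bullet> x = 0" "(x \<star> y) \<bullet> (x \<star> y) = (x \<bullet> x) * (y \<bullet> y)" by auto
qed

lemma vprod_perp_component:
  obtains c y' where "y = c *\<^sub>R x + y'" "x \<bullet> y' = 0"
proof (cases "x = 0")
  case True
  then show ?thesis using that[of 0 y] by simp
next
  case False
  show ?thesis
    by (rule that[of "(x \<bullet> y) / (x \<bullet> x)" "y - ((x \<bullet> y) / (x \<bullet> x)) *\<^sub>R x"])
      (use False in \<open>simp_all add: inner_simps\<close>)
qed

lemma vprod_inner_left [simp]: "(x \<star> y) \<bullet> x = 0"
proof -
  obtain c y' where y: "y = c *\<^sub>R x + y'" "x \<bullet> y' = 0" by (rule vprod_perp_component)
  then have "x \<star> y = x \<star> y'" by (simp add: vprod_simps)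
  then show ?thesis using vprod_orthogonal_args(1)[OF y(2)] by simp
qed

lemma vprod_inner_right [simp]: "(x \<star> y) \<bullet> y = 0"
  by (subst vprod_anticommute) simp

lemma vprod_inner_left' [simp]: "x \<bullet> (x \<star> y) = 0"
  and vprod_inner_right' [simp]: "y \<bullet> (x \<star> y) = 0"
  using vprod_inner_left vprod_inner_right by (simp_all add: inner_commute)

text \<open>Only the component of the second factor orthogonal to the first contributes.\<close>

lemma vprod_inner_self: "(x \<star> y) \<bullet> (x \<star> y) = (x \<bullet> x) * (y \<bullet> y) - (x \<bullet> y)\<^sup>2"
proof -
  obtain c y' where y: "y = c *\<^sub>R x + y'" "x \<bullet> y' = 0" by (rule vprod_perp_component)
  then have "x \<star> y = x \<star> y'" by (simp add: vprod_simps)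
  then show ?thesis using vprod_orthogonal_args(2)[OF y(2)] y(2)
    by (simp add: y(1) inner_simps inner_commute[of y' x] power2_eq_square algebra_simps)
qed

text \<open>The trilinear form is alternating, because it vanishes when a factor is repeated.\<close>

lemma vprod_inner_rotate: "(x \<star> y) \<bullet> z = (y \<star> z) \<bullet> x"
proof -
  have "(x \<star> (y + z)) \<bullet> (y + z) = 0" by (rule vprod_inner_right)
  then have 1: "(x \<star> y) \<bullet> z = - ((x \<star> z) \<bullet> y)"
    by (simp add: vprod_simps inner_simps)
  have "((y + x) \<star> z) \<bullet> (y + x) = 0" by (rule vprod_inner_left)
  then have "(x \<star> z) \<bullet> y = - ((y \<star> z) \<bullet> x)"
    by (simp add: vprod_simps inner_simps)
  with 1 show ?thesis by simp
qed

lemma vprod_inner_shift: "(x \<star> y) \<bullet> z = x \<bullet> (y \<star> z)"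
  using vprod_inner_rotate by (simp add: inner_commute)

text \<open>Polarization of the formula for the length of a product.\<close>

lemma vprod_inner_common: "(x \<star> y) \<bullet> (x \<star> z) = (x \<bullet> x) * (y \<bullet> z) - (x \<bullet> y) * (x \<bullet> z)"
proof -
  have "(x \<star> (y + z)) \<bullet> (x \<star> (y + z)) = (x \<bullet> x) * ((y + z) \<bullet> (y + z)) - (x \<bullet> (y + z))\<^sup>2"
    by (rule vprod_inner_self)
  then show ?thesis
    using vprod_inner_self[of x y] vprod_inner_self[of x z]
    by (simp add: vprod_simps inner_simps power2_eq_square algebra_simps inner_commute)
qed

lemma vprod_inner_common_right:
  "(y \<star> x) \<bullet> (z \<star> x) = (x \<bullet> x) * (y \<bullet> z) - (x \<bullet> y) * (x \<bullet> z)"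
  using vprod_inner_common[of x y z] vprod_anticommute[of y x] vprod_anticommute[of z x] by simp

text \<open>Both sides have the same inner product with every vector, by the rotation rule and the
  polarized length formula.\<close>

lemma vprod_left_left: "x \<star> (x \<star> y) = (x \<bullet> y) *\<^sub>R x - (x \<bullet> x) *\<^sub>R y"
proof (rule inner_eq_zero_iff [THEN iffD1, THEN eq_iff_diff_eq_0 [THEN iffD2]])
  have *: "(x \<star> (x \<star> y)) \<bullet> z = ((x \<bullet> y) *\<^sub>R x - (x \<bullet> x) *\<^sub>R y) \<bullet> z" for z
  proof -
    have "(x \<star> (x \<star> y)) \<bullet> z = (z \<star> x) \<bullet> (x \<star> y)"
      using vprod_inner_rotate[of z x "x \<star> y"] by simp
    also have "\<dots> = - ((x \<star> z) \<bullet> (x \<star> y))" using vprod_anticommute[of z x] by simp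
    finally show ?thesis by (simp add: vprod_inner_common inner_simps inner_commute)
  qed
  show "(x \<star> (x \<star> y) - ((x \<bullet> y) *\<^sub>R x - (x \<bullet> x) *\<^sub>R y)) \<bullet>
      (x \<star> (x \<star> y) - ((x \<bullet> y) *\<^sub>R x - (x \<bullet> x) *\<^sub>R y)) = 0"
    by (simp only: inner_diff_left[of "x \<star> (x \<star> y)"] *)
qed

text \<open>This linearization of the previous identity in its left factor takes the place of associativity:
  it moves a factor past another one.\<close>

lemma vprod_swap:
  "x \<star> (w \<star> y) = (x \<bullet> y) *\<^sub>R w + (w \<bullet> y) *\<^sub>R x - (2 * (x \<bullet> w)) *\<^sub>R y - w \<star> (x \<star> y)"
proof -
  have "(x + w) \<star> ((x + w) \<star> y) = ((x + w) \<bullet> y) *\<^sub>R (x + w) - ((x + w) \<bullet> (x + w)) *\<^sub>R y"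
    by (rule vprod_left_left)
  then show ?thesis
    by (simp add: vprod_simps inner_simps vprod_left_left inner_commute[of w x] algebra_simps)
qed

lemma vprod_swap_orth:
  assumes "x \<bullet> y = 0" "w \<bullet> y = 0" "x \<bullet> w = 0"
  shows "x \<star> (w \<star> y) = - (w \<star> (x \<star> y))"
  using vprod_swap[of x w y] assms by simp

end

section \<open>Families indexed by a seven-element type\<close>

lemma exhaust_7:
  fixes i :: 7
  shows "i = 1 \<or> i = 2 \<or> i = 3 \<or> i = 4 \<or> i = 5 \<or> i = 6 \<or> i = 7"
proof (induct i)
  case (of_int z)
  then have "z = 0 \<or> z = 1 \<or> z = 2 \<or> z = 3 \<or> z = 4 \<or> z = 5 \<or> z = 6" by simp arith
  then show ?case by auto
qed

lemma forall_7:
  "(\<forall>i::7. P i) \<longleftrightarrow> P 1 \<and> P 2 \<and> P 3 \<and> P 4 \<and> P 5 \<and> P 6 \<and> P 7"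
proof safe
  fix i :: 7
  assume "P 1" "P 2" "P 3" "P 4" "P 5" "P 6" "P 7"
  then show "P i" using exhaust_7[of i] by (elim disjE) simp_all
qed auto

lemma UNIV_7: "UNIV = {1::7, 2, 3, 4, 5, 6, 7}"
  using exhaust_7 by auto

lemma sum_7: "sum f (UNIV :: 7 set) = f 1 + f 2 + f 3 + f 4 + f 5 + f 6 + f 7"
  unfolding UNIV_7 by (simp add: ac_simps)

lemma vector_7 [simp]:
  "(vector [a, b, c, d, e, f, g] :: 'a::zero^7) $ 1 = a"
  "(vector [a, b, c, d, e, f, g] :: 'a::zero^7) $ 2 = b"
  "(vector [a, b, c, d, e, f, g] :: 'a::zero^7) $ 3 = c"
  "(vector [a, b, c, d, e, f, g] :: 'a::zero^7) $ 4 = d"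
  "(vector [a, b, c, d, e, f, g] :: 'a::zero^7) $ 5 = e"
  "(vector [a, b, c, d, e, f, g] :: 'a::zero^7) $ 6 = f"
  "(vector [a, b, c, d, e, f, g] :: 'a::zero^7) $ 7 = g"
  unfolding vector_def by simp_all

section \<open>Orthonormal families\<close>

definition orthonormal_family :: "'v::euclidean_space^'n \<Rightarrow> bool" where
  "orthonormal_family b \<longleftrightarrow> (\<forall>i j. b $ i \<bullet> b $ j = (if i = j then 1 else 0))"

lemma orthonormal_familyD: "orthonormal_family b \<Longrightarrow> b $ i \<bullet> b $ j = (if i = j then 1 else 0)"
  by (simp add: orthonormal_family_def)

lemma orthonormal_family_inj:
  assumes "orthonormal_family b"
  shows "inj (($) b)"
proof (rule injI)
  fix i j assume "b $ i = b $ j"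
  then show "i = j"
    using orthonormal_familyD[OF assms, of i j] orthonormal_familyD[OF assms, of j j]
    by (auto split: if_splits)
qed

lemma orthonormal_family_independent:
  assumes "orthonormal_family b"
  shows "independent (range (($) b))"
proof (rule pairwise_orthogonal_independent)
  show "pairwise orthogonal (range (($) b))"
    using orthonormal_familyD[OF assms] by (auto simp: pairwise_def orthogonal_def)
  show "0 \<notin> range (($) b)"
    using orthonormal_familyD[OF assms] by (metis (no_types, lifting) imageE inner_zero_left zero_neq_one)
qed

lemma orthonormal_family_expand:
  fixes b :: "'v::euclidean_space^'n"
  assumes "orthonormal_family b" and "DIM('v) = CARD('n)"
  shows "x = (\<Sum>i\<in>UNIV. (x \<bullet> b $ i) *\<^sub>R b $ i)"
proof -
  have "card (range (($) b)) = DIM('v)"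
    using card_image[OF orthonormal_family_inj[OF assms(1)]] assms(2) by simp
  then have span: "span (range (($) b)) = UNIV"
    using orthonormal_family_independent[OF assms(1)] card_eq_dim[of "range (($) b)" UNIV] by auto
  have "(x - (\<Sum>i\<in>UNIV. (x \<bullet> b $ i) *\<^sub>R b $ i)) \<bullet> b $ j = 0" for j
    by (simp add: inner_diff_left inner_sum_left orthonormal_familyD[OF assms(1)] if_distrib cong: if_cong)
  then have "orthogonal (x - (\<Sum>i\<in>UNIV. (x \<bullet> b $ i) *\<^sub>R b $ i)) y" for y
    using span by (intro orthogonal_to_span[of y "range (($) b)"]) (auto simp: orthogonal_def)
  from this[of "x - (\<Sum>i\<in>UNIV. (x \<bullet> b $ i) *\<^sub>R b $ i)"] show ?thesis
    by (simp add: orthogonal_def)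
qed

section \<open>The multiplication table of a Cayley triple\<close>

context cross_product
begin

lemma cayley_triple_iff:
  "cayley_triple (\<star>) (u, v, z) \<longleftrightarrow>
     u \<bullet> u = 1 \<and> v \<bullet> v = 1 \<and> z \<bullet> z = 1 \<and> u \<bullet> v = 0 \<and> u \<bullet> z = 0 \<and> v \<bullet> z = 0 \<and> (u \<star> v) \<bullet> z = 0"
  (is "_ \<longleftrightarrow> ?R")
proof
  assume "cayley_triple (\<star>) (u, v, z)"
  then show ?R
    by (auto simp: cayley_triple_def orthonormal_def pairwise_def orthogonal_def norm_eq_1)
next
  assume R: ?R
  have "(u \<star> v) \<bullet> (u \<star> v) = 1" using R by (simp add: vprod_inner_self)
  moreover have "distinct [u, v, u \<star> v, z]"
  proof -
    have "u \<noteq> v" "u \<noteq> z" "v \<noteq> z" "u \<star> v \<noteq> z" using R by auto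
    moreover have "u \<star> v \<noteq> u" "u \<star> v \<noteq> v"
      by (metis R vprod_inner_left vprod_inner_right zero_neq_one)+
    ultimately show ?thesis by auto
  qed
  ultimately show "cayley_triple (\<star>) (u, v, z)"
    using R by (auto simp: cayley_triple_def orthonormal_def pairwise_def orthogonal_def
        norm_eq_1 inner_commute)
qed

context
  fixes u v z w
  assumes cayley: "cayley_triple (\<star>) (u, v, z)" and w: "w = u \<star> v"
begin

lemma cayley_inner_generators:
  "u \<bullet> u = 1" "v \<bullet> v = 1" "w \<bullet> w = 1" "z \<bullet> z = 1"
  "u \<bullet> v = 0" "u \<bullet> w = 0" "v \<bullet> w = 0" "u \<bullet> z = 0" "v \<bullet> z = 0" "w \<bullet> z = 0"
  "v \<bullet> u = 0" "w \<bullet> u = 0" "w \<bullet> v = 0" "z \<bullet> u = 0" "z \<bullet> v = 0" "z \<bullet> w = 0"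
  using cayley unfolding w cayley_triple_iff
  by (auto simp: vprod_inner_self inner_commute)

text \<open>The quaternion relations follow from uv = w and the formula for x(xy) alone.\<close>

lemma cayley_quaternion_table:
  "u \<star> v = w" "v \<star> u = - w" "v \<star> w = u" "w \<star> v = - u" "w \<star> u = v" "u \<star> w = - v"
proof -
  show uv: "u \<star> v = w" and vu: "v \<star> u = - w"
    using w vprod_anticommute[of v u] by simp_all
  show uw: "u \<star> w = - v" and vw: "v \<star> w = u"
    using vprod_left_left[of u v] vprod_left_left[of v u] uv vu cayley_inner_generators
    by (simp_all add: vprod_simps)
  show "w \<star> v = - u" "w \<star> u = v"
    using uw vw by (auto intro: vprod_flip)
qed

lemma cayley_inner_products:
  "(x \<star> z) \<bullet> (y \<star> z) = x \<bullet> y - (z \<bullet> x) * (z \<bullet> y)"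
  "u \<bullet> (v \<star> z) = 0" "v \<bullet> (u \<star> z) = 0" "u \<bullet> (w \<star> z) = 0"
  "w \<bullet> (u \<star> z) = 0" "v \<bullet> (w \<star> z) = 0" "w \<bullet> (v \<star> z) = 0"
  "(v \<star> z) \<bullet> u = 0" "(u \<star> z) \<bullet> v = 0" "(w \<star> z) \<bullet> u = 0"
  "(u \<star> z) \<bullet> w = 0" "(w \<star> z) \<bullet> v = 0" "(v \<star> z) \<bullet> w = 0"
proof -
  show 1: "u \<bullet> (v \<star> z) = 0" "v \<bullet> (u \<star> z) = 0" "u \<bullet> (w \<star> z) = 0"
    "w \<bullet> (u \<star> z) = 0" "v \<bullet> (w \<star> z) = 0" "w \<bullet> (v \<star> z) = 0"
    by (simp_all add: cayley_quaternion_table cayley_inner_generators flip: vprod_inner_shift)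
  then show "(v \<star> z) \<bullet> u = 0" "(u \<star> z) \<bullet> v = 0" "(w \<star> z) \<bullet> u = 0"
    "(u \<star> z) \<bullet> w = 0" "(w \<star> z) \<bullet> v = 0" "(v \<star> z) \<bullet> w = 0"
    by (simp_all only: inner_commute)
qed (simp add: vprod_inner_common_right cayley_inner_generators)

text \<open>Moving factors past each other with \<open>vprod_swap_orth\<close> reduces every product involving z to the
  quaternion table. Hence the structure constants do not depend on the triple.\<close>

lemma cayley_octonion_table:
  "z \<star> (u \<star> z) = u" "z \<star> (v \<star> z) = v" "z \<star> (w \<star> z) = w"
  "u \<star> (u \<star> z) = - z" "v \<star> (v \<star> z) = - z" "w \<star> (w \<star> z) = - z"
  "u \<star> (v \<star> z) = - (w \<star> z)" "v \<star> (w \<star> z) = - (u \<star> z)" "w \<star> (u \<star> z) = - (v \<star> z)"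
  "v \<star> (u \<star> z) = w \<star> z" "w \<star> (v \<star> z) = u \<star> z" "u \<star> (w \<star> z) = v \<star> z"
  "(u \<star> z) \<star> (v \<star> z) = - w" "(v \<star> z) \<star> (w \<star> z) = - u" "(u \<star> z) \<star> (w \<star> z) = v"
proof -
  have zz: "z \<star> (x \<star> z) = x - (z \<bullet> x) *\<^sub>R z" for x
    using vprod_left_left[of z x] vprod_anticommute[of x z]
    by (simp add: vprod_simps cayley_inner_generators)
  show z: "z \<star> (u \<star> z) = u" "z \<star> (v \<star> z) = v" "z \<star> (w \<star> z) = w"
    by (simp_all add: zz cayley_inner_generators)
  show "u \<star> (u \<star> z) = - z" "v \<star> (v \<star> z) = - z" "w \<star> (w \<star> z) = - z"
    by (simp_all add: vprod_left_left cayley_inner_generators)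
  have sw: "x \<star> (y \<star> z) = - ((x \<star> y) \<star> z)" if "x \<bullet> y = 0" "x \<bullet> z = 0" "y \<bullet> z = 0" for x y
    using vprod_swap_orth[of x y z] vprod_swap_orth[of x z y] that
      vprod_anticommute[of y z] vprod_anticommute[of z "x \<star> y"]
    by (simp add: vprod_simps inner_commute)
  show s: "u \<star> (v \<star> z) = - (w \<star> z)" "v \<star> (w \<star> z) = - (u \<star> z)" "w \<star> (u \<star> z) = - (v \<star> z)"
    "v \<star> (u \<star> z) = w \<star> z" "w \<star> (v \<star> z) = u \<star> z" "u \<star> (w \<star> z) = v \<star> z"
    by (simp_all add: sw cayley_inner_generators cayley_quaternion_table vprod_simps)
  have dd: "(x \<star> z) \<star> (y \<star> z) = - (z \<star> (y \<star> (x \<star> z)))"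
    if "x \<bullet> y = 0" "y \<bullet> z = 0" "(x \<star> z) \<bullet> y = 0" for x y
    using vprod_swap_orth[of "x \<star> z" y z] that vprod_anticommute[of y z]
      vprod_anticommute[of "x \<star> z" y]
    by (simp add: vprod_simps inner_commute)
  show "(u \<star> z) \<star> (v \<star> z) = - w" "(v \<star> z) \<star> (w \<star> z) = - u" "(u \<star> z) \<star> (w \<star> z) = v"
    by (simp_all add: dd cayley_inner_generators cayley_inner_products s z vprod_simps)
qed

lemma cayley_octonion_table_reverse:
  "(u \<star> z) \<star> z = - u" "(v \<star> z) \<star> z = - v" "(w \<star> z) \<star> z = - w"
  "(u \<star> z) \<star> u = z" "(v \<star> z) \<star> v = z" "(w \<star> z) \<star> w = z"
  "(v \<star> z) \<star> u = w \<star> z" "(w \<star> z) \<star> v = u \<star> z" "(u \<star> z) \<star> w = v \<star> z"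
  "(u \<star> z) \<star> v = - (w \<star> z)" "(v \<star> z) \<star> w = - (u \<star> z)" "(w \<star> z) \<star> u = - (v \<star> z)"
  "(v \<star> z) \<star> (u \<star> z) = w" "(w \<star> z) \<star> (v \<star> z) = u" "(w \<star> z) \<star> (u \<star> z) = - v"
proof -
  show "(u \<star> z) \<star> z = - u" "(v \<star> z) \<star> z = - v" "(w \<star> z) \<star> z = - w"
    "(u \<star> z) \<star> u = z" "(v \<star> z) \<star> v = z" "(w \<star> z) \<star> w = z"
    "(v \<star> z) \<star> u = w \<star> z" "(w \<star> z) \<star> v = u \<star> z" "(u \<star> z) \<star> w = v \<star> z"
    "(u \<star> z) \<star> v = - (w \<star> z)" "(v \<star> z) \<star> w = - (u \<star> z)" "(w \<star> z) \<star> u = - (v \<star> z)"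
    "(v \<star> z) \<star> (u \<star> z) = w" "(w \<star> z) \<star> (v \<star> z) = u" "(w \<star> z) \<star> (u \<star> z) = - v"
    by (rule vprod_flip; simp add: cayley_octonion_table)+
qed

end

lemma cayley_basis_nth:
  "cayley_basis (\<star>) (u, v, z) $ 1 = u" "cayley_basis (\<star>) (u, v, z) $ 2 = v"
  "cayley_basis (\<star>) (u, v, z) $ 3 = u \<star> v" "cayley_basis (\<star>) (u, v, z) $ 4 = z"
  "cayley_basis (\<star>) (u, v, z) $ 5 = u \<star> z" "cayley_basis (\<star>) (u, v, z) $ 6 = v \<star> z"
  "cayley_basis (\<star>) (u, v, z) $ 7 = (u \<star> v) \<star> z"
  by (simp_all add: cayley_basis_def)

lemma cayley_basis_orthonormal:
  assumes "cayley_triple (\<star>) t"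
  shows "orthonormal_family (cayley_basis (\<star>) t)"
proof -
  obtain u v z where t: "t = (u, v, z)" by (cases t)
  define w where "w = u \<star> v"
  note c = assms[unfolded t]
  show ?thesis
    unfolding orthonormal_family_def forall_7 t cayley_basis_nth w_def[symmetric]
    by (simp add: cayley_inner_generators[OF c w_def] cayley_inner_products[OF c w_def])
qed

end

section \<open>Coordinates and matrices in an orthonormal basis\<close>

lemma orthonormal_family_eqI:
  fixes b :: "'v::euclidean_space^'n"
  assumes "orthonormal_family b" and "DIM('v) = CARD('n)" and "\<And>i. x \<bullet> b $ i = y \<bullet> b $ i"
  shows "x = y"
  using orthonormal_family_expand[OF assms(1,2), of x] orthonormal_family_expand[OF assms(1,2), of y]
    assms(3) by simp

lemma linear_orthonormal_family_eqI:
  fixes b :: "'v::euclidean_space^'n"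
  assumes "orthonormal_family b" and "DIM('v) = CARD('n)" and "linear f" "linear g"
    and "\<And>i. f (b $ i) = g (b $ i)"
  shows "f x = g x"
  by (subst (1 2) orthonormal_family_expand[OF assms(1,2), of x])
    (simp add: linear_sum linear_scale assms(3-5))

lemma representation_orthonormal_family:
  fixes b :: "'v::euclidean_space^'n"
  assumes "orthonormal_family b" and "DIM('v) = CARD('n)"
  shows "representation (range (\<lambda>k. b $ k)) x (b $ i) = x \<bullet> b $ i"
proof -
  let ?B = "range (($) b)"
  note ind = orthonormal_family_independent[OF assms(1)]
  have "representation ?B x = representation ?B (\<Sum>j\<in>UNIV. (x \<bullet> b $ j) *\<^sub>R b $ j)"
    using orthonormal_family_expand[OF assms, of x] by simp
  also have "\<dots> = (\<lambda>e. \<Sum>j\<in>UNIV. representation ?B ((x \<bullet> b $ j) *\<^sub>R b $ j) e)"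
    using ind by (intro representation_sum) (auto intro: span_base span_scale)
  also have "\<dots> = (\<lambda>e. \<Sum>j\<in>UNIV. (x \<bullet> b $ j) * (if e = b $ j then 1 else 0))"
    using ind by (simp add: representation_scale representation_basis span_base cong: if_cong)
  finally show ?thesis
    by (simp add: inj_eq[OF orthonormal_family_inj[OF assms(1)]] if_distrib cong: if_cong)
qed

lemma matrix_wrt_orthonormal:
  fixes b :: "'v::euclidean_space^'n"
  assumes "orthonormal_family b" and "DIM('v) = CARD('n)"
  shows "matrix_wrt b \<delta> $ i $ j = \<delta> (b $ j) \<bullet> b $ i"
  by (simp add: matrix_wrt_def representation_orthonormal_family[OF assms])

definition of_coords :: "'v::euclidean_space^'n \<Rightarrow> real^'n \<Rightarrow> 'v" where
  "of_coords b y = (\<Sum>i\<in>UNIV. y $ i *\<^sub>R b $ i)"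

definition coords :: "'v::euclidean_space^'n \<Rightarrow> 'v \<Rightarrow> real^'n" where
  "coords b x = (\<chi> i. x \<bullet> b $ i)"

definition endo_of :: "'v::euclidean_space^'n \<Rightarrow> real^'n^'n \<Rightarrow> 'v \<Rightarrow> 'v" where
  "endo_of b M x = of_coords b (M *v coords b x)"

lemma linear_of_coords: "linear (of_coords b)"
  by (rule linearI) (simp_all add: of_coords_def scaleR_left_distrib sum.distrib scaleR_sum_right)

lemma linear_coords: "linear (coords b)"
  by (rule linearI) (simp_all add: coords_def vec_eq_iff inner_simps)

lemma inner_of_coords: "of_coords b y \<bullet> x = y \<bullet> coords b x"
  by (simp add: of_coords_def coords_def inner_sum_left inner_vec_def inner_commute[of "b $ _"])

context
  fixes b :: "'v::euclidean_space^'n"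
  assumes onb: "orthonormal_family b" and dim: "DIM('v) = CARD('n)"
begin

lemma inj_on_matrix_wrt: "inj_on (matrix_wrt b) sym_endo"
proof (rule inj_onI)
  fix \<delta> \<epsilon> assume d: "\<delta> \<in> sym_endo" "\<epsilon> \<in> sym_endo" and eq: "matrix_wrt b \<delta> = matrix_wrt b \<epsilon>"
  have "\<delta> (b $ j) \<bullet> b $ i = \<epsilon> (b $ j) \<bullet> b $ i" for i j
    by (simp flip: matrix_wrt_orthonormal[OF onb dim] add: eq)
  then have eq: "\<delta> (b $ j) = \<epsilon> (b $ j)" for j
    by (rule orthonormal_family_eqI[OF onb dim])
  have "linear \<delta>" "linear \<epsilon>"
    using d unfolding sym_endo_def by blast+
  then have "\<delta> x = \<epsilon> x" for x
    using eq by (rule linear_orthonormal_family_eqI[OF onb dim])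
  then show "\<delta> = \<epsilon>" by auto
qed

lemma coords_of_coords [simp]: "coords b (of_coords b y) = y"
  by (simp add: coords_def of_coords_def vec_eq_iff inner_sum_left orthonormal_familyD[OF onb]
      if_distrib cong: if_cong)

lemma of_coords_coords [simp]: "of_coords b (coords b x) = x"
  using orthonormal_family_expand[OF onb dim, of x] by (simp add: coords_def of_coords_def)

lemma endo_of_sym_endo:
  assumes "M \<in> sym_mat"
  shows "endo_of b M \<in> sym_endo"
proof -
  have "linear (of_coords b \<circ> ((*v) M) \<circ> coords b)"
    by (intro linear_compose linear_coords linear_of_coords matrix_vector_mul_linear)
  moreover have "of_coords b \<circ> ((*v) M) \<circ> coords b = endo_of b M"
    by (auto simp: endo_of_def)
  moreover have "endo_of b M x \<bullet> y = x \<bullet> endo_of b M y" for x y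
  proof -
    have "endo_of b M x \<bullet> y = (M *v coords b x) \<bullet> coords b y"
      by (simp add: endo_of_def inner_of_coords)
    also have "\<dots> = coords b x \<bullet> (M *v coords b y)"
      using assms dot_lmul_matrix[of "coords b x" M "coords b y"]
      by (simp add: sym_mat_def flip: transpose_matrix_vector)
    also have "\<dots> = endo_of b M y \<bullet> x"
      by (simp add: endo_of_def inner_of_coords inner_commute[of "coords b x"])
    finally show ?thesis by (simp add: inner_commute)
  qed
  ultimately show ?thesis unfolding sym_endo_def by simp
qed

lemma coords_basis: "coords b (b $ j) = axis j 1"
  by (simp add: coords_def vec_eq_iff axis_def orthonormal_familyD[OF onb])

lemma matrix_wrt_endo_of: "matrix_wrt b (endo_of b M) = M"
proof -
  have "matrix_wrt b (endo_of b M) $ i $ j = M $ i $ j" for i j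
    by (simp add: matrix_wrt_orthonormal[OF onb dim] endo_of_def inner_of_coords coords_basis
        inner_axis matrix_vector_mul_component)
  then show ?thesis by (simp add: vec_eq_iff)
qed

lemma endo_of_eigenspace: "{x. endo_of b M x = l *\<^sub>R x} = of_coords b ` eigenspace M l"
proof -
  have "endo_of b M x = l *\<^sub>R x \<longleftrightarrow> M *v coords b x = l *\<^sub>R coords b x" for x
    unfolding endo_of_def by (metis coords_of_coords of_coords_coords linear_coords linear_scale)
  then have "{x. endo_of b M x = l *\<^sub>R x} = {x. coords b x \<in> eigenspace M l}"
    by (simp add: eigenspace_def)
  also have "\<dots> = of_coords b ` eigenspace M l"
  proof (intro equalityI subsetI)
    fix x assume "x \<in> {x. coords b x \<in> eigenspace M l}"
    then show "x \<in> of_coords b ` eigenspace M l"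
      by (intro image_eqI[of x "of_coords b" "coords b x"]) auto
  qed auto
  finally show ?thesis .
qed

lemma dim_endo_of_eigenspace: "dim {x. endo_of b M x = l *\<^sub>R x} = dim (eigenspace M l)"
  unfolding endo_of_eigenspace
  by (rule dim_image_eq[OF linear_of_coords]) (metis coords_of_coords inj_onI)

lemma the_inv_into_matrix_wrt:
  "\<delta> \<in> sym_endo \<Longrightarrow> the_inv_into sym_endo (matrix_wrt b) (matrix_wrt b \<delta>) = \<delta>"
  by (rule the_inv_into_f_f[OF inj_on_matrix_wrt])

end

section \<open>Orbits as changes of Cayley triple\<close>

context cross_product
begin

lemma aut_cayley_triple:
  assumes "g \<in> aut_vp (\<star>)" and "cayley_triple (\<star>) (u, v, z)"
  shows "cayley_triple (\<star>) (g u, g v, g z)"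
proof -
  have "g x \<bullet> g y = x \<bullet> y" "g (x \<star> y) = g x \<star> g y" for x y
    using assms(1) by (auto simp: aut_vp_def orthogonal_transformation_def)
  note this(1) this(2)[symmetric]
  then show ?thesis using assms(2) by (simp add: cayley_triple_iff)
qed

lemma aut_cayley_basis:
  assumes "g \<in> aut_vp (\<star>)"
  shows "cayley_basis (\<star>) (g u, g v, g z) $ i = g (cayley_basis (\<star>) (u, v, z) $ i)"
proof -
  have "g (x \<star> y) = g x \<star> g y" for x y
    using assms(1) by (auto simp: aut_vp_def)
  then have "\<forall>i. cayley_basis (\<star>) (g u, g v, g z) $ i = g (cayley_basis (\<star>) (u, v, z) $ i)"
    unfolding forall_7 cayley_basis_nth by simp
  then show ?thesis ..
qed

text \<open>The isometry matching the two bases preserves the product of any two basis vectors, because both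
  bases have the same multiplication table; bilinearity does the rest.\<close>

lemma cayley_triples_conjugate:
  assumes "DIM('v) = 7" and s: "cayley_triple (\<star>) (u, v, z)" and t: "cayley_triple (\<star>) (u', v', z')"
  obtains g where "g \<in> aut_vp (\<star>)" "g u = u'" "g v = v'" "g z = z'"
proof -
  have card: "DIM('v) = CARD(7)" using assms(1) by simp
  let ?b = "cayley_basis (\<star>) (u, v, z)" and ?c = "cayley_basis (\<star>) (u', v', z')"
  note b = cayley_basis_orthonormal[OF s] and c = cayley_basis_orthonormal[OF t]
  define g where "g x = (\<Sum>i\<in>UNIV. (x \<bullet> ?b $ i) *\<^sub>R ?c $ i)" for x
  have lin: "linear g"
    by (rule linearI) (simp_all add: g_def inner_simps scaleR_left_distrib sum.distrib scaleR_sum_right)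
  have gb: "g (?b $ i) = ?c $ i" for i
    by (simp add: g_def orthonormal_familyD[OF b] if_distrib[of "\<lambda>r. r *\<^sub>R _"] cong: if_cong)
  have "g x \<bullet> g y = x \<bullet> y" for x y
  proof -
    have "g x \<bullet> g y = (\<Sum>i\<in>UNIV. (x \<bullet> ?b $ i) * (y \<bullet> ?b $ i))"
      by (simp add: g_def inner_sum_left inner_sum_right orthonormal_familyD[OF c] if_distrib
          mult.commute cong: if_cong)
    also have "\<dots> = x \<bullet> (\<Sum>i\<in>UNIV. (y \<bullet> ?b $ i) *\<^sub>R ?b $ i)"
      unfolding inner_sum_right inner_scaleR_right by (rule sum.cong[OF refl mult.commute])
    finally show ?thesis using orthonormal_family_expand[OF b card, of y] by simp
  qed
  then have orth: "orthogonal_transformation g"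
    using lin by (simp add: orthogonal_transformation_def)
  define w w' where "w = u \<star> v" and "w' = u' \<star> v'"
  have gbs: "g u = u'" "g v = v'" "g w = w'" "g z = z'"
    "g (u \<star> z) = u' \<star> z'" "g (v \<star> z) = v' \<star> z'" "g (w \<star> z) = w' \<star> z'"
    using gb[of 1] gb[of 2] gb[of 3] gb[of 4] gb[of 5] gb[of 6] gb[of 7]
    unfolding cayley_basis_nth w_def[symmetric] w'_def[symmetric] by simp_all
  have zt: "z \<star> u = - (u \<star> z)" "z \<star> v = - (v \<star> z)" "z \<star> w = - (w \<star> z)"
    "z' \<star> u' = - (u' \<star> z')" "z' \<star> v' = - (v' \<star> z')" "z' \<star> w' = - (w' \<star> z')"
    by (rule vprod_anticommute)+
  note tab = cayley_quaternion_table[OF s w_def] cayley_quaternion_table[OF t w'_def]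
    cayley_octonion_table[OF s w_def] cayley_octonion_table[OF t w'_def]
    cayley_octonion_table_reverse[OF s w_def] cayley_octonion_table_reverse[OF t w'_def]
  have prod: "\<forall>i j. g (?b $ i \<star> ?b $ j) = ?c $ i \<star> ?c $ j"
    unfolding forall_7 cayley_basis_nth w_def[symmetric] w'_def[symmetric]
    by (simp add: tab zt gbs linear_neg[OF lin] linear_0[OF lin])
  have "g (x \<star> y) = g x \<star> g y" for x y
  proof -
    have l: "linear (\<lambda>x. g (x \<star> y))" "linear (\<lambda>x. g x \<star> g y)"
       "linear (\<lambda>y. g (x \<star> y))" "linear (\<lambda>y. g x \<star> g y)" for x y
      by (rule linearI; simp add: vprod_simps linear_add[OF lin] linear_scale[OF lin])+
    have "g (?b $ i \<star> y) = ?c $ i \<star> g y" for i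
      using linear_orthonormal_family_eqI[OF b card l(3) l(4), of "?b $ i" "?b $ i" y] prod
      by (simp add: gb)
    then show ?thesis
      using linear_orthonormal_family_eqI[OF b card l(1) l(2), of y y x] by (simp add: gb)
  qed
  then have "g \<in> aut_vp (\<star>)" using orth by (simp add: aut_vp_def)
  then show thesis using that gbs by blast
qed

text \<open>Conjugating \<delta> by an automorphism g has the same effect on the matrix as replacing the basis by
  its image under g, which is the basis of another Cayley triple.\<close>

lemma mat_orbit_eq:
  assumes "DIM('v) = 7" and s: "cayley_triple (\<star>) s" and "\<delta> \<in> sym_endo"
  shows "mat_orbit (\<star>) s (matrix_wrt (cayley_basis (\<star>) s) \<delta>) =
    {matrix_wrt (cayley_basis (\<star>) t) \<delta> | t. cayley_triple (\<star>) t}"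
proof -
  have card: "DIM('v) = CARD(7)" using assms(1) by simp
  obtain u v z where s_eq: "s = (u, v, z)" by (cases s)
  have act: "mat_act (\<star>) s (matrix_wrt (cayley_basis (\<star>) s) \<delta>) g =
      matrix_wrt (cayley_basis (\<star>) (g u, g v, g z)) \<delta>" if g: "g \<in> aut_vp (\<star>)" for g
  proof -
    let ?b = "cayley_basis (\<star>) s" and ?c = "cayley_basis (\<star>) (g u, g v, g z)"
    have gb: "?c $ i = g (?b $ i)" for i
      using aut_cayley_basis[OF g] s_eq by simp
    have orth: "orthogonal_transformation g" using g by (simp add: aut_vp_def)
    then have inv: "inv g x \<bullet> y = x \<bullet> g y" for x y
      by (metis orthogonal_transformation_def orthogonal_transformation_surj surj_f_inv_f)
    have "mat_act (\<star>) s (matrix_wrt ?b \<delta>) g = matrix_wrt ?b (inv g \<circ> \<delta> \<circ> g)"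
      using the_inv_into_matrix_wrt[OF cayley_basis_orthonormal[OF s] card assms(3)]
      by (simp add: mat_act_def)
    also have "\<dots> = matrix_wrt ?c \<delta>"
      using aut_cayley_triple[OF g] s unfolding s_eq
      by (simp add: vec_eq_iff matrix_wrt_orthonormal[OF cayley_basis_orthonormal card] inv
          aut_cayley_basis[OF g])
    finally show ?thesis .
  qed
  show ?thesis
  proof (intro equalityI subsetI)
    fix N assume "N \<in> mat_orbit (\<star>) s (matrix_wrt (cayley_basis (\<star>) s) \<delta>)"
    then obtain g where "g \<in> aut_vp (\<star>)" "N = matrix_wrt (cayley_basis (\<star>) (g u, g v, g z)) \<delta>"
      using act by (auto simp: mat_orbit_def)
    then show "N \<in> {matrix_wrt (cayley_basis (\<star>) t) \<delta> | t. cayley_triple (\<star>) t}"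
      using aut_cayley_triple s s_eq by blast
  next
    fix N assume "N \<in> {matrix_wrt (cayley_basis (\<star>) t) \<delta> | t. cayley_triple (\<star>) t}"
    then obtain u' v' z' where t: "cayley_triple (\<star>) (u', v', z')"
      and N: "N = matrix_wrt (cayley_basis (\<star>) (u', v', z')) \<delta>" by auto
    obtain g where "g \<in> aut_vp (\<star>)" "g u = u'" "g v = v'" "g z = z'"
      using cayley_triples_conjugate[OF assms(1) s[unfolded s_eq] t] .
    then show "N \<in> mat_orbit (\<star>) s (matrix_wrt (cayley_basis (\<star>) s) \<delta>)"
      using act N by (auto simp: mat_orbit_def)
  qed
qed

end

section \<open>Diagonalized matrices and the normal forms\<close>

lemma block_diag_mult:
  "block_diag X A B ** block_diag X' A' B' = block_diag (X ** X') (A ** A') (B ** B')"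
  unfolding vec_eq_iff forall_7
  by (simp add: block_diag_def matrix_matrix_mult_def sum_7 sum_2 sum_3)

lemma block_diag_transpose:
  "transpose (block_diag X A B) = block_diag (transpose X) (transpose A) (transpose B)"
  unfolding vec_eq_iff forall_7 by (simp add: block_diag_def transpose_def)

lemma block_diag_mat_1: "block_diag (mat 1) (mat 1) (mat 1) = mat 1"
  unfolding vec_eq_iff forall_7 by (simp add: block_diag_def mat_def)

lemma orthogonal_matrix_Rot: "orthogonal_matrix (Rot \<alpha>)"
  unfolding orthogonal_matrix vec_eq_iff forall_2
  by (simp add: matrix_matrix_mult_def transpose_def mat_def sum_2 Rot_def
      flip: power2_eq_square)

lemma orthogonal_matrix_SRot: "orthogonal_matrix (SRot \<theta> \<phi>)"
proof -
  have c: "cos \<theta> * cos \<theta> = 1 - sin \<theta> * sin \<theta>" "cos \<phi> * cos \<phi> = 1 - sin \<phi> * sin \<phi>"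
    using sin_cos_squared_add3[of \<theta>] sin_cos_squared_add3[of \<phi>] by linarith+
  have c': "cos \<theta> * (cos \<theta> * x) = x - sin \<theta> * (sin \<theta> * x)"
    "cos \<phi> * (cos \<phi> * x) = x - sin \<phi> * (sin \<phi> * x)" for x
    unfolding mult.assoc[symmetric] c by (simp_all add: left_diff_distrib)
  show ?thesis
    unfolding orthogonal_matrix vec_eq_iff forall_3
    by (simp add: matrix_matrix_mult_def transpose_def mat_def sum_3 SRot_def algebra_simps c c')
qed

lemma orthogonal_matrix_inv: "orthogonal_matrix P \<Longrightarrow> matrix_inv P = transpose P"
  for P :: "real^'n^'n"
  unfolding matrix_inv_def orthogonal_matrix_def
  by (rule some_equality) (metis matrix_mul_assoc matrix_mul_lid matrix_mul_rid)+

definition diagonal_matrix :: "real^'n \<Rightarrow> real^'n^'n" where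
  "diagonal_matrix d = (\<chi> i j. if i = j then d $ i else 0)"

lemma diagonal_matrix_vector_mult: "diagonal_matrix d *v x = (\<chi> i. d $ i * x $ i)"
  by (simp add: diagonal_matrix_def matrix_vector_mult_def vec_eq_iff if_distrib
      if_distribR cong: if_cong)

definition frame :: "real \<Rightarrow> real \<Rightarrow> real \<Rightarrow> real^7^7" where
  "frame \<alpha> \<theta> \<phi> = block_diag (mat 1) (Rot \<alpha>) (SRot \<theta> \<phi>)"

lemma orthogonal_matrix_frame: "orthogonal_matrix (frame \<alpha> \<theta> \<phi>)"
  using orthogonal_matrix_Rot[of \<alpha>] orthogonal_matrix_SRot[of \<theta> \<phi>]
  by (simp add: frame_def orthogonal_matrix block_diag_transpose block_diag_mult block_diag_mat_1
      transpose_mat)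

text \<open>The block form is convenient to write down, the diagonalized form to reason about: its eigenvectors
  are the rows of the frame matrix.\<close>

lemma normal_form_eq:
  "block_diag (\<nu> *\<^sub>R mat 1)
      (matrix_inv (Rot \<alpha>) ** diag2 \<nu> \<mu> ** Rot \<alpha>)
      (matrix_inv (SRot \<theta> \<phi>) ** diag3 \<mu> lam \<kappa> ** SRot \<theta> \<phi>) =
    transpose (frame \<alpha> \<theta> \<phi>) ** diagonal_matrix (vector [\<nu>, \<nu>, \<nu>, \<mu>, \<mu>, lam, \<kappa>]) ** frame \<alpha> \<theta> \<phi>"
proof -
  have "diagonal_matrix (vector [\<nu>, \<nu>, \<nu>, \<mu>, \<mu>, lam, \<kappa>]) =
      block_diag (\<nu> *\<^sub>R mat 1) (diag2 \<nu> \<mu>) (diag3 \<mu> lam \<kappa>)"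
    unfolding vec_eq_iff forall_7
    by (simp add: diagonal_matrix_def block_diag_def diag2_def diag3_def mat_def)
  then show ?thesis
    by (simp add: frame_def block_diag_transpose block_diag_mult transpose_mat
        orthogonal_matrix_inv orthogonal_matrix_Rot orthogonal_matrix_SRot)
qed

lemma transpose_diagonalized:
  "transpose (transpose P ** diagonal_matrix d ** P) = transpose P ** diagonal_matrix d ** P"
proof -
  have "transpose (diagonal_matrix d) = diagonal_matrix d"
    by (auto simp: diagonal_matrix_def transpose_def vec_eq_iff)
  then show ?thesis by (simp add: matrix_transpose_mul matrix_mul_assoc)
qed

text \<open>The substitution y = Px turns the eigenvector equation into conditions on the single coordinates
  of y.\<close>

lemma spectral_data_diagonalized:
  fixes P :: "real^'n^'n"
  assumes "orthogonal_matrix P"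
  shows "spectral_data (transpose P ** diagonal_matrix d ** P) =
    (\<lambda>l. (l, card {i. d $ i = l})) ` range (($) d)"
proof -
  let ?M = "transpose P ** diagonal_matrix d ** P"
  have PP: "P *v (transpose P *v y) = y" "transpose P *v (P *v y) = y" for y
    using assms by (simp_all add: matrix_vector_mul_assoc orthogonal_matrix_def del: transpose_matrix_vector)
  have eig: "?M *v x = l *\<^sub>R x \<longleftrightarrow> (\<forall>i. i \<notin> {i. d $ i = l} \<longrightarrow> (P *v x) $ i = 0)" for x l
  proof -
    have "?M *v x = l *\<^sub>R x \<longleftrightarrow> diagonal_matrix d *v (P *v x) = l *\<^sub>R (P *v x)"
      by (metis PP matrix_vector_mul_assoc matrix_vector_mult_scaleR)
    also have "\<dots> \<longleftrightarrow> (\<forall>i. i \<notin> {i. d $ i = l} \<longrightarrow> (P *v x) $ i = 0)"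
      by (auto simp: diagonal_matrix_vector_mult vec_eq_iff)
    finally show ?thesis .
  qed
  have dim: "dim (eigenspace ?M l) = card {i. d $ i = l}" for l
  proof -
    let ?S = "{y :: real^'n. \<forall>i. i \<notin> {i. d $ i = l} \<longrightarrow> y $ i = 0}"
    have "eigenspace ?M l = (*v) (transpose P) ` ?S"
    proof (intro equalityI subsetI)
      fix x assume "x \<in> eigenspace ?M l"
      then have "P *v x \<in> ?S" unfolding eigenspace_def mem_Collect_eq eig .
      then show "x \<in> (*v) (transpose P) ` ?S"
        by (rule rev_image_eqI) (simp only: PP)
    next
      fix x assume "x \<in> (*v) (transpose P) ` ?S"
      then obtain y where "y \<in> ?S" "x = transpose P *v y" by auto
      then show "x \<in> eigenspace ?M l" unfolding eigenspace_def mem_Collect_eq eig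
        by (simp add: PP del: transpose_matrix_vector)
    qed
    moreover have "inj_on ((*v) (transpose P)) (span ?S)"
      by (rule inj_on_inverseI[of _ "(*v) P"]) (simp only: PP)
    then have "dim ((*v) (transpose P) ` ?S) = dim ?S"
      by (rule dim_image_eq[OF matrix_vector_mul_linear])
    ultimately have "dim (eigenspace ?M l) = dim ?S" by (simp only:)
    also have "\<dots> = card {i. d $ i = l}"
      unfolding dim_vec_eq[symmetric] by (rule dim_substandard_cart)
    finally show ?thesis .
  qed
  have "(\<exists>x. x \<noteq> 0 \<and> ?M *v x = l *\<^sub>R x) \<longleftrightarrow> l \<in> range (($) d)" for l
  proof
    assume "\<exists>x. x \<noteq> 0 \<and> ?M *v x = l *\<^sub>R x"
    then obtain x where x: "x \<noteq> 0" "?M *v x = l *\<^sub>R x" by blast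
    then have "P *v x \<noteq> 0" by (metis PP(2) matrix_vector_mult_0_right)
    then obtain i where "(P *v x) $ i \<noteq> 0" by (auto simp: vec_eq_iff)
    with x(2)[unfolded eig] show "l \<in> range (($) d)" by auto
  next
    assume "l \<in> range (($) d)"
    then obtain i where "l = d $ i" by auto
    moreover have "transpose P *v axis i 1 \<noteq> 0"
      by (metis PP(1) axis_eq_0_iff matrix_vector_mult_0_right zero_neq_one)
    moreover have "\<forall>j. j \<notin> {j. d $ j = d $ i} \<longrightarrow> (P *v (transpose P *v axis i 1)) $ j = 0"
      by (auto simp: PP axis_def simp del: transpose_matrix_vector)
    ultimately show "\<exists>x. x \<noteq> 0 \<and> ?M *v x = l *\<^sub>R x" unfolding eig by blast
  qed
  then show ?thesis by (auto simp: spectral_data_def dim)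
qed

lemma spectral_data_normal_form:
  fixes P :: "real^7^7"
  assumes "distinct [\<kappa>, lam, \<mu>, \<nu>]" and "orthogonal_matrix P"
  shows "spectral_data (transpose P ** diagonal_matrix (vector [\<nu>, \<nu>, \<nu>, \<mu>, \<mu>, lam, \<kappa>]) ** P) =
    {(\<kappa>, 1), (lam, 1), (\<mu>, 2), (\<nu>, 3)}"
proof -
  let ?d = "vector [\<nu>, \<nu>, \<nu>, \<mu>, \<mu>, lam, \<kappa>] :: real^7"
  have "{i. ?d $ i = \<nu>} = {1, 2, 3}" "{i. ?d $ i = \<mu>} = {4, 5}"
    "{i. ?d $ i = lam} = {6}" "{i. ?d $ i = \<kappa>} = {7}"
    unfolding set_eq_iff forall_7 using assms(1) by auto
  moreover have "range (($) ?d) = {\<kappa>, lam, \<mu>, \<nu>}"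
    unfolding UNIV_7 image_insert image_empty vector_7 by blast
  ultimately show ?thesis
    unfolding spectral_data_diagonalized[OF assms(2)] by (simp add: numeral_2_eq_2 numeral_3_eq_3)
qed

text \<open>Compare the columns of \<open>M ** transpose P\<close> and \<open>transpose P ** D\<close>: the k-th ones express the two
  sides of the eigenvector equation for the vector with coordinates \<open>P $ k\<close>.\<close>

lemma matrix_wrt_eq_diagonalized_iff:
  fixes b :: "'v::euclidean_space^'n"
  assumes onb: "orthonormal_family b" "DIM('v) = CARD('n)" and P: "orthogonal_matrix P"
    and lin: "linear \<delta>"
  shows "matrix_wrt b \<delta> = transpose P ** diagonal_matrix d ** P \<longleftrightarrow>
    (\<forall>k. \<delta> (of_coords b (P $ k)) = d $ k *\<^sub>R of_coords b (P $ k))"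
proof -
  let ?M = "matrix_wrt b \<delta>" and ?D = "diagonal_matrix d"
  have L: "(?M ** transpose P) $ i $ k = \<delta> (of_coords b (P $ k)) \<bullet> b $ i" for i k
    by (simp add: matrix_matrix_mult_def transpose_def matrix_wrt_orthonormal[OF onb] of_coords_def
        linear_sum[OF lin] linear_scale[OF lin] inner_sum_left mult.commute)
  have R: "(transpose P ** ?D) $ i $ k = (d $ k *\<^sub>R of_coords b (P $ k)) \<bullet> b $ i" for i k
    by (simp add: matrix_matrix_mult_def transpose_def diagonal_matrix_def of_coords_def
        inner_sum_left orthonormal_familyD[OF onb(1)] if_distrib cong: if_cong)
  have "?M = transpose P ** ?D ** P \<longleftrightarrow> ?M ** transpose P = transpose P ** ?D"
    using P by (metis matrix_mul_assoc matrix_mul_rid orthogonal_matrix_def)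
  also have "\<dots> \<longleftrightarrow> (\<forall>k i. \<delta> (of_coords b (P $ k)) \<bullet> b $ i = (d $ k *\<^sub>R of_coords b (P $ k)) \<bullet> b $ i)"
    unfolding vec_eq_iff L R by blast
  also have "\<dots> \<longleftrightarrow> (\<forall>k. \<delta> (of_coords b (P $ k)) = d $ k *\<^sub>R of_coords b (P $ k))"
  proof (intro iffI allI)
    fix k assume "\<forall>k i. \<delta> (of_coords b (P $ k)) \<bullet> b $ i = (d $ k *\<^sub>R of_coords b (P $ k)) \<bullet> b $ i"
    then show "\<delta> (of_coords b (P $ k)) = d $ k *\<^sub>R of_coords b (P $ k)"
      by (intro orthonormal_family_eqI[OF onb]) simp
  qed simp
  finally show ?thesis .
qed

lemma orthonormal_family_rotate:
  fixes b :: "'v::euclidean_space^'n"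
  assumes onb: "orthonormal_family b" and P: "orthogonal_matrix P"
  shows "orthonormal_family (\<chi> k. of_coords b (P $ k))"
proof -
  have "of_coords b y \<bullet> b $ i = y $ i" for y i
    by (simp add: of_coords_def inner_sum_left orthonormal_familyD[OF onb] if_distrib
        cong: if_cong)
  then have "of_coords b (P $ j) \<bullet> of_coords b (P $ k) = (P ** transpose P) $ j $ k" for j k
    by (simp add: of_coords_def[of b "P $ k"] inner_sum_right matrix_matrix_mult_def
        transpose_def mult.commute)
  then show ?thesis
    using P by (simp add: orthonormal_family_def orthogonal_matrix_def mat_def)
qed

context cross_product
begin

text \<open>The candidate eigenbasis u, v, n, m, m', l, k attached to a Cayley triple and three angles.\<close>

definition eigenframe :: "'v \<times> 'v \<times> 'v \<Rightarrow> real \<Rightarrow> real \<Rightarrow> real \<Rightarrow> 'v^7" where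
  "eigenframe t \<alpha> \<theta> \<phi> = (\<chi> k. of_coords (cayley_basis (\<star>) t) (frame \<alpha> \<theta> \<phi> $ k))"

lemma eigenframe_nth:
  "eigenframe (u, v, z) \<alpha> \<theta> \<phi> $ 1 = u"
  "eigenframe (u, v, z) \<alpha> \<theta> \<phi> $ 2 = v"
  "eigenframe (u, v, z) \<alpha> \<theta> \<phi> $ 3 = cos \<alpha> *\<^sub>R (u \<star> v) - sin \<alpha> *\<^sub>R z"
  "eigenframe (u, v, z) \<alpha> \<theta> \<phi> $ 4 = sin \<alpha> *\<^sub>R (u \<star> v) + cos \<alpha> *\<^sub>R z"
  "eigenframe (u, v, z) \<alpha> \<theta> \<phi> $ 5 = cos \<theta> *\<^sub>R (u \<star> z) - (cos \<phi> * sin \<theta>) *\<^sub>R (v \<star> z)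
      + (sin \<phi> * sin \<theta>) *\<^sub>R ((u \<star> v) \<star> z)"
  "eigenframe (u, v, z) \<alpha> \<theta> \<phi> $ 6 = sin \<theta> *\<^sub>R (u \<star> z) + (cos \<phi> * cos \<theta>) *\<^sub>R (v \<star> z)
      - (sin \<phi> * cos \<theta>) *\<^sub>R ((u \<star> v) \<star> z)"
  "eigenframe (u, v, z) \<alpha> \<theta> \<phi> $ 7 = sin \<phi> *\<^sub>R (v \<star> z) + cos \<phi> *\<^sub>R ((u \<star> v) \<star> z)"
  by (simp_all add: eigenframe_def of_coords_def sum_7 cayley_basis_nth frame_def block_diag_def
      mat_def Rot_def SRot_def)

lemma eigenframe_orthonormal:
  "cayley_triple (\<star>) t \<Longrightarrow> orthonormal_family (eigenframe t \<alpha> \<theta> \<phi>)"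
  unfolding eigenframe_def
  by (intro orthonormal_family_rotate cayley_basis_orthonormal orthogonal_matrix_frame)

lemma matrix_wrt_normal_form_iff:
  assumes "DIM('v) = 7" and t: "cayley_triple (\<star>) t" and "linear \<delta>"
  shows "matrix_wrt (cayley_basis (\<star>) t) \<delta> =
      transpose (frame \<alpha> \<theta> \<phi>) ** diagonal_matrix d ** frame \<alpha> \<theta> \<phi> \<longleftrightarrow>
    (\<forall>k. \<delta> (eigenframe t \<alpha> \<theta> \<phi> $ k) = d $ k *\<^sub>R eigenframe t \<alpha> \<theta> \<phi> $ k)"
proof -
  have "DIM('v) = CARD(7)" using assms(1) by simp
  from matrix_wrt_eq_diagonalized_iff[OF cayley_basis_orthonormal[OF t] this
      orthogonal_matrix_frame assms(3)]
  show ?thesis by (simp add: eigenframe_def)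
qed

end

section \<open>Eigenvectors of symmetric endomorphisms\<close>

text \<open>A subspace meets the orthogonal complement of too small a set for reasons of dimension.\<close>

lemma unit_vector_orthogonal_exists:
  fixes S :: "'v::euclidean_space set"
  assumes "subspace S" and "finite B" and "card B < dim S"
  shows "\<exists>x\<in>S. norm x = 1 \<and> (\<forall>b\<in>B. x \<bullet> b = 0)"
proof -
  let ?T = "{y \<in> UNIV. \<forall>x\<in>span B. orthogonal x y}"
  have "dim ?T + dim (span B) = dim (UNIV :: 'v set)"
    by (rule dim_subspace_orthogonal_to_vectors) auto
  moreover have "dim (span B) \<le> card B"
    using assms(2) by (simp add: dim_le_card')
  moreover have "subspace ?T"
    by (auto simp: subspace_def orthogonal_clauses)
  then have "dim {x + y |x y. x \<in> S \<and> y \<in> ?T} + dim (S \<inter> ?T) = dim S + dim ?T"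
    by (rule dim_sums_Int[OF assms(1)])
  moreover have "dim {x + y |x y. x \<in> S \<and> y \<in> ?T} \<le> dim (UNIV :: 'v set)"
    by (rule dim_subset) simp
  ultimately have "dim (S \<inter> ?T) > 0" using assms(3) by linarith
  then have "\<not> S \<inter> ?T \<subseteq> {0}" by (simp only: flip: dim_eq_0)
  then obtain x where x: "x \<in> S" "x \<in> ?T" "x \<noteq> 0" by blast
  show ?thesis
  proof (intro bexI conjI ballI)
    show "x /\<^sub>R norm x \<in> S" using x(1) assms(1) by (simp add: subspace_scale)
    show "norm (x /\<^sub>R norm x) = 1" using x(3) by simp
    show "(x /\<^sub>R norm x) \<bullet> b = 0" if "b \<in> B" for b
      using x(2) span_base[OF that] by (simp add: orthogonal_def inner_commute)
  qed
qed

text \<open>Every point of the unit circle is moved into the first quadrant by an overall sign \<sigma> and a sign \<epsilon>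
  of the first coordinate. The overall sign is harmless for eigenvectors; the other sign is absorbed
  by a change of the Cayley triple.\<close>

lemma unit_circle_first_quadrant:
  fixes x y :: real
  assumes "x\<^sup>2 + y\<^sup>2 = 1"
  obtains t \<epsilon> \<sigma> where "0 \<le> t" "t \<le> pi / 2" "\<epsilon> \<in> {1, -1}" "\<sigma> \<in> {1, -1}"
    "x = \<sigma> * \<epsilon> * sin t" "y = \<sigma> * cos t"
proof -
  define t where "t = arccos \<bar>y\<bar>"
  have y: "\<bar>y\<bar> \<le> 1" using assms abs_square_le_1[of y] by (smt (verit) zero_le_power2)
  have t: "0 \<le> t" "t \<le> pi / 2" "cos t = \<bar>y\<bar>"
    unfolding t_def using y by (intro arccos_lbound arccos_le_pi2 cos_arccos; linarith)+
  have "(sin t)\<^sup>2 = x\<^sup>2" using assms t(3) by (simp add: sin_squared_eq)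
  moreover have "sin t \<ge> 0" using t by (intro sin_ge_zero) auto
  ultimately have st: "sin t = \<bar>x\<bar>" by (metis abs_of_nonneg power2_eq_iff_nonneg power2_abs abs_ge_zero)
  define \<sigma> \<tau> :: real where "\<sigma> = (if y < 0 then -1 else 1)" and "\<tau> = (if x < 0 then -1 else 1)"
  show thesis
    by (rule that[of t "\<sigma> * \<tau>" \<sigma>]) (use t st in \<open>auto simp: \<sigma>_def \<tau>_def\<close>)
qed

lemma sym_endo_eigenvectors_orthogonal:
  assumes "\<delta> \<in> sym_endo" and "\<delta> x = l *\<^sub>R x" "\<delta> y = l' *\<^sub>R y" "l \<noteq> l'"
  shows "x \<bullet> y = 0"
proof -
  have "\<delta> x \<bullet> y = x \<bullet> \<delta> y" using assms(1) unfolding sym_endo_def by blast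
  then show ?thesis using assms(2-4) by simp
qed

lemma subspace_eigenspace: "linear \<delta> \<Longrightarrow> subspace {x. \<delta> x = l *\<^sub>R x}"
  by (auto simp: subspace_def linear_0 linear_add linear_scale scaleR_add_right)

text \<open>Eigenspaces whose dimensions add up to the whole dimension have orthonormal bases that together
  form a basis of the space. Expanding x in it, only the vectors of the remaining eigenspace occur.\<close>

lemma eigenspace_complement:
  fixes \<delta> :: "'v::euclidean_space \<Rightarrow> 'v"
  assumes \<delta>: "\<delta> \<in> sym_endo" and "finite L" and dim: "(\<Sum>l\<in>L. dim {x. \<delta> x = l *\<^sub>R x}) = DIM('v)"
    and l: "l \<in> L" and orth: "\<And>l' y. l' \<in> L \<Longrightarrow> l' \<noteq> l \<Longrightarrow> \<delta> y = l' *\<^sub>R y \<Longrightarrow> x \<bullet> y = 0"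
  shows "\<delta> x = l *\<^sub>R x"
proof -
  have lin: "linear \<delta>" using \<delta> by (simp add: sym_endo_def)
  have "\<forall>l. \<exists>B. B \<subseteq> {x. \<delta> x = l *\<^sub>R x} \<and> pairwise orthogonal B \<and> (\<forall>x\<in>B. norm x = 1) \<and>
      independent B \<and> card B = dim {x. \<delta> x = l *\<^sub>R x}"
    using orthonormal_basis_subspace[OF subspace_eigenspace[OF lin]] by metis
  then obtain B where B: "\<And>l. B l \<subseteq> {x. \<delta> x = l *\<^sub>R x}" "\<And>l. pairwise orthogonal (B l)"
    "\<And>l x. x \<in> B l \<Longrightarrow> norm x = 1" "\<And>l. independent (B l)"
    "\<And>l. card (B l) = dim {x. \<delta> x = l *\<^sub>R x}" by metis
  define C where "C = (\<Union>l\<in>L. B l)"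
  have zero: "0 \<notin> C" using B(3) by (force simp: C_def)
  have pw: "pairwise orthogonal C"
    unfolding pairwise_def orthogonal_def C_def
  proof safe
    fix x y l l' assume "l \<in> L" "l' \<in> L" "x \<in> B l" "y \<in> B l'" "x \<noteq> y"
    then show "x \<bullet> y = 0"
      using B(1,2) sym_endo_eigenvectors_orthogonal[OF \<delta>, of x l y l']
      by (cases "l = l'") (auto simp: pairwise_def orthogonal_def)
  qed
  have fin: "finite (B l)" for l using B(4) independent_imp_finite by blast
  have "card C = (\<Sum>l\<in>L. card (B l))"
    unfolding C_def
  proof (rule card_UN_disjoint[OF \<open>finite L\<close>])
    show "\<forall>l\<in>L. \<forall>l'\<in>L. l \<noteq> l' \<longrightarrow> B l \<inter> B l' = {}"
    proof (intro ballI impI)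
      fix l l' :: real assume "l \<noteq> l'"
      then have "y \<bullet> y = 0" if "y \<in> B l" "y \<in> B l'" for y
        using that B(1) sym_endo_eigenvectors_orthogonal[OF \<delta>, of y l y l'] by blast
      then show "B l \<inter> B l' = {}" using B(3) by fastforce
    qed
  qed (use fin in auto)
  then have card: "card C = DIM('v)" using B(5) dim by simp
  have finC: "finite C" using fin \<open>finite L\<close> by (auto simp: C_def)
  have "independent C" using pairwise_orthogonal_independent[OF pw zero] .
  then have "span C = UNIV"
    using card card_eq_dim[of C UNIV] finC by auto
  moreover have "norm b = 1" if "b \<in> C" for b using that B(3) by (auto simp: C_def)
  ultimately have x: "x = (\<Sum>b\<in>C. (x \<bullet> b) *\<^sub>R b)"
    using orthonormal_basis_expand[OF pw _ _ finC, of x] by simp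
  have "\<delta> x = (\<Sum>b\<in>C. (x \<bullet> b) *\<^sub>R \<delta> b)"
    by (subst x) (simp add: linear_sum[OF lin] linear_scale[OF lin])
  also have "\<dots> = (\<Sum>b\<in>C. (x \<bullet> b) *\<^sub>R (l *\<^sub>R b))"
  proof (rule sum.cong[OF refl])
    fix b assume "b \<in> C"
    then obtain l' where l': "l' \<in> L" "\<delta> b = l' *\<^sub>R b" using B(1) by (auto simp: C_def)
    then show "(x \<bullet> b) *\<^sub>R \<delta> b = (x \<bullet> b) *\<^sub>R (l *\<^sub>R b)"
      using orth[OF l'(1) _ l'(2)] by (cases "l' = l") auto
  qed
  also have "\<dots> = l *\<^sub>R x"
    by (subst (2) x) (simp add: scaleR_sum_right mult.commute)
  finally show ?thesis .
qed

text \<open>An eigenvector for the remaining eigenvalue is orthogonal to all other members of the family, so it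
  is a nonzero multiple of the missing one.\<close>

lemma orthonormal_family_last_eigenvector:
  fixes c :: "'v::euclidean_space^'n"
  assumes \<delta>: "\<delta> \<in> sym_endo" and c: "orthonormal_family c" "DIM('v) = CARD('n)"
    and eig: "\<And>i. i \<noteq> j \<Longrightarrow> \<delta> (c $ i) = d $ i *\<^sub>R c $ i" and ne: "\<And>i. i \<noteq> j \<Longrightarrow> d $ i \<noteq> d $ j"
    and y: "y \<noteq> 0" "\<delta> y = d $ j *\<^sub>R y"
  shows "\<delta> (c $ j) = d $ j *\<^sub>R c $ j"
proof -
  have lin: "linear \<delta>" using \<delta> by (simp add: sym_endo_def)
  have "y \<bullet> c $ i = 0" if "i \<noteq> j" for i
    using sym_endo_eigenvectors_orthogonal[OF \<delta> y(2) eig[OF that]] ne[OF that] by metis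
  then have "(\<Sum>i\<in>UNIV. (y \<bullet> c $ i) *\<^sub>R c $ i) = (\<Sum>i\<in>UNIV. if i = j then (y \<bullet> c $ j) *\<^sub>R c $ j else 0)"
    by (intro sum.cong) auto
  then have "y = (\<Sum>i\<in>UNIV. if i = j then (y \<bullet> c $ j) *\<^sub>R c $ j else 0)"
    using orthonormal_family_expand[OF c, of y] by simp
  then have yj: "y = (y \<bullet> c $ j) *\<^sub>R c $ j" by simp
  with y(1) have "y \<bullet> c $ j \<noteq> 0" by auto
  moreover have "(y \<bullet> c $ j) *\<^sub>R \<delta> (c $ j) = (y \<bullet> c $ j) *\<^sub>R (d $ j *\<^sub>R c $ j)"
    using y(2) yj linear_scale[OF lin, of "y \<bullet> c $ j" "c $ j"] by (metis scaleR_left_commute)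
  ultimately show ?thesis by (simp only: scaleR_cancel_left) simp
qed

lemma eigenbasis_inner_eq_0:
  assumes "\<delta> \<in> sym_endo" "\<And>i. \<delta> (c $ i) = d $ i *\<^sub>R c $ i" "\<delta> x = l *\<^sub>R x" "d $ i \<noteq> l"
  shows "x \<bullet> c $ i = 0"
  using sym_endo_eigenvectors_orthogonal[OF assms(1,3) assms(2)[of i]] assms(4) by metis

section \<open>The vector orthogonal to a three-dimensional subspace and its products\<close>

context cross_product
begin

context
  fixes u v z w n m f and \<alpha> :: real
  assumes dim7: "DIM('v) = 7" and cayley: "cayley_triple (\<star>) (u, v, z)" and w: "w = u \<star> v"
    and n: "n = cos \<alpha> *\<^sub>R w - sin \<alpha> *\<^sub>R z" and m: "m = sin \<alpha> *\<^sub>R w + cos \<alpha> *\<^sub>R z"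
    and f: "f = w \<star> z"
begin

lemmas triple_inner = cayley_inner_generators[OF cayley w]
lemmas triple_quaternion_table = cayley_quaternion_table[OF cayley w]
lemmas triple_octonion_table = cayley_octonion_table[OF cayley w] cayley_octonion_table_reverse[OF cayley w]
lemmas triple_inner_products = cayley_inner_products[OF cayley w]

lemma frame_expand:
  "x = (x \<bullet> u) *\<^sub>R u + (x \<bullet> v) *\<^sub>R v + (x \<bullet> n) *\<^sub>R n + (x \<bullet> m) *\<^sub>R m
     + (x \<bullet> (u \<star> z)) *\<^sub>R (u \<star> z) + (x \<bullet> (v \<star> z)) *\<^sub>R (v \<star> z) + (x \<bullet> f) *\<^sub>R f"
proof -
  have "(x \<bullet> n) *\<^sub>R n + (x \<bullet> m) *\<^sub>R m = (x \<bullet> w) *\<^sub>R w + (x \<bullet> z) *\<^sub>R z"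
  proof -
    have "(x \<bullet> (c *\<^sub>R w - s *\<^sub>R z)) *\<^sub>R (c *\<^sub>R w - s *\<^sub>R z) + (x \<bullet> (s *\<^sub>R w + c *\<^sub>R z)) *\<^sub>R (s *\<^sub>R w + c *\<^sub>R z) =
        ((c\<^sup>2 + s\<^sup>2) * (x \<bullet> w)) *\<^sub>R w + ((c\<^sup>2 + s\<^sup>2) * (x \<bullet> z)) *\<^sub>R z" for c s :: real
      by (simp add: inner_right_distrib inner_diff_right algebra_simps power2_eq_square)
    from this[of "cos \<alpha>" "sin \<alpha>"] show ?thesis by (simp add: n m)
  qed
  moreover have "DIM('v) = CARD(7)" using dim7 by simp
  note orthonormal_family_expand[OF cayley_basis_orthonormal[OF cayley] this, of x]
  ultimately have "x = (x \<bullet> u) *\<^sub>R u + (x \<bullet> v) *\<^sub>R v + ((x \<bullet> n) *\<^sub>R n + (x \<bullet> m) *\<^sub>R m)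
     + (x \<bullet> (u \<star> z)) *\<^sub>R (u \<star> z) + (x \<bullet> (v \<star> z)) *\<^sub>R (v \<star> z) + (x \<bullet> f) *\<^sub>R f"
    by (simp add: sum_7 cayley_basis_nth w f add.assoc)
  then show ?thesis by (simp only: add.assoc)
qed

lemma plane_normal_inner:
  "n \<bullet> n = 1" "n \<bullet> u = 0" "n \<bullet> v = 0" "u \<bullet> n = 0" "v \<bullet> n = 0"
  "m \<bullet> m = 1" "m \<bullet> u = 0" "m \<bullet> v = 0" "m \<bullet> n = 0" "n \<bullet> m = 0" "w \<bullet> n = cos \<alpha>"
  "f \<bullet> f = 1" "f \<bullet> u = 0" "f \<bullet> v = 0" "f \<bullet> n = 0" "f \<bullet> m = 0"
  "f \<bullet> (u \<star> z) = 0" "f \<bullet> (v \<star> z) = 0" "f \<bullet> w = 0"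
proof -
  have sc: "sin \<alpha> * sin \<alpha> + cos \<alpha> * cos \<alpha> = 1" "cos \<alpha> * cos \<alpha> + sin \<alpha> * sin \<alpha> = 1"
    using sin_cos_squared_add3[of \<alpha>] by linarith+
  show "n \<bullet> n = 1" "m \<bullet> m = 1" "m \<bullet> n = 0" "n \<bullet> m = 0" "w \<bullet> n = cos \<alpha>"
    "n \<bullet> u = 0" "n \<bullet> v = 0" "u \<bullet> n = 0" "v \<bullet> n = 0" "m \<bullet> u = 0" "m \<bullet> v = 0"
    unfolding n m by (simp_all add: inner_simps triple_inner sc)
  show "f \<bullet> f = 1" "f \<bullet> u = 0" "f \<bullet> v = 0" "f \<bullet> w = 0" "f \<bullet> n = 0" "f \<bullet> m = 0"
    "f \<bullet> (u \<star> z) = 0" "f \<bullet> (v \<star> z) = 0"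
    unfolding n m f by (simp_all add: inner_simps triple_inner triple_inner_products)
qed

text \<open>The first three products say that multiplication by f maps the span of u, v, n isometrically onto the
  span of m, uz, vz; the last two show which products of vectors of the span leave it.\<close>

lemma plane_normal_vprod:
  "u \<star> f = v \<star> z" "v \<star> f = - (u \<star> z)" "n \<star> f = - m"
  "u \<star> n = - (cos \<alpha> *\<^sub>R v) - sin \<alpha> *\<^sub>R (u \<star> z)" "v \<star> n = cos \<alpha> *\<^sub>R u - sin \<alpha> *\<^sub>R (v \<star> z)"
  unfolding n m f by (simp_all add: vprod_simps triple_quaternion_table triple_octonion_table)

text \<open>If sin \<alpha> is not 0, then u, v, n and their products span the orthogonal complement of f.\<close>

lemma plane_normal_unique:
  assumes "sin \<alpha> \<noteq> 0" "g \<bullet> g = 1" "g \<bullet> u = 0" "g \<bullet> v = 0" "g \<bullet> n = 0"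
    "g \<bullet> w = 0" "g \<bullet> (u \<star> n) = 0" "g \<bullet> (v \<star> n) = 0"
  shows "g = f \<or> g = - f"
proof -
  have "g \<bullet> z = 0" using assms(1,5,6) unfolding n by (simp add: inner_simps)
  then have "g \<bullet> m = 0" using assms(6) unfolding m by (simp add: inner_simps)
  moreover have "g \<bullet> (u \<star> z) = 0" "g \<bullet> (v \<star> z) = 0"
    using assms(1,3,4,7,8) unfolding plane_normal_vprod by (simp_all add: inner_simps)
  ultimately have g: "g = (g \<bullet> f) *\<^sub>R f" using assms frame_expand[of g] by simp
  have "(g \<bullet> f) * (g \<bullet> f) = 1"
    using assms(2) arg_cong[OF g, of "\<lambda>x. x \<bullet> x"] by (simp add: plane_normal_inner(12))
  then have "g \<bullet> f = 1 \<or> g \<bullet> f = -1" by (simp add: square_eq_1_iff)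
  then show ?thesis using g by (metis scaleR_one scaleR_minus1_left)
qed

text \<open>Projected back to the span of u, v, n, the vector product is cos \<alpha> times the usual cross product of
  the coordinates.\<close>

lemma plane_normal_vprod_inner:
  assumes x: "x = x1 *\<^sub>R u + x2 *\<^sub>R v + x3 *\<^sub>R n" and y: "y = y1 *\<^sub>R u + y2 *\<^sub>R v + y3 *\<^sub>R n"
  shows "(x \<star> y) \<bullet> f = 0" "(x \<star> y) \<bullet> u = cos \<alpha> * (x2 * y3 - x3 * y2)"
    "(x \<star> y) \<bullet> v = cos \<alpha> * (x3 * y1 - x1 * y3)" "(x \<star> y) \<bullet> n = cos \<alpha> * (x1 * y2 - x2 * y1)"
proof -
  have fl: "n \<star> u = - (u \<star> n)" "n \<star> v = - (v \<star> n)" by (rule vprod_anticommute)+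
  have xy: "x \<star> y = (x1 * y2 - x2 * y1) *\<^sub>R w + (x1 * y3 - x3 * y1) *\<^sub>R (u \<star> n)
      + (x2 * y3 - x3 * y2) *\<^sub>R (v \<star> n)"
    unfolding x y by (simp add: vprod_simps triple_quaternion_table fl algebra_simps)
  have fz: "(u \<star> z) \<bullet> f = 0" "(v \<star> z) \<bullet> f = 0" "u \<bullet> f = 0" "v \<bullet> f = 0" "w \<bullet> f = 0"
    using plane_normal_inner by (simp_all add: inner_commute)
  show "(x \<star> y) \<bullet> f = 0"
    unfolding xy plane_normal_vprod by (simp add: inner_simps fz)
  show "(x \<star> y) \<bullet> n = cos \<alpha> * (x1 * y2 - x2 * y1)"
    unfolding xy by (simp add: inner_simps plane_normal_inner)
  show "(x \<star> y) \<bullet> u = cos \<alpha> * (x2 * y3 - x3 * y2)" "(x \<star> y) \<bullet> v = cos \<alpha> * (x3 * y1 - x1 * y3)"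
    unfolding xy plane_normal_vprod by (simp_all add: inner_simps triple_inner triple_inner_products algebra_simps)
qed

end

end

section \<open>Existence of an adapted Cayley triple\<close>

lemma unit_vector_spans_line:
  fixes S :: "'v::euclidean_space set"
  assumes "subspace S" "dim S = 1" "e \<in> S" "norm e = 1" "y \<in> S"
  shows "y = (y \<bullet> e) *\<^sub>R e"
proof -
  have "e \<noteq> 0" using assms(4) by auto
  have "span {e} \<subseteq> S" using assms(1,3) by (simp add: span_minimal)
  moreover have "dim (span {e}) = 1"
    using \<open>e \<noteq> 0\<close> dim_eq_card_independent[of "{e}"] by simp
  ultimately have "span {e} = S"
    using subspace_dim_equal[OF subspace_span assms(1)] assms(2) by simp
  then obtain c where "y = c *\<^sub>R e" using assms(5) by (auto simp: span_singleton)
  then show ?thesis using assms(4) by (simp add: norm_eq_1)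
qed

context cross_product
begin

context
  fixes \<delta> :: "'v \<Rightarrow> 'v" and \<kappa> lam \<mu> \<nu> :: real and d :: "real^7"
  assumes dim7: "DIM('v) = 7" and \<delta>: "\<delta> \<in> sym_endo" and distinct: "distinct [\<kappa>, lam, \<mu>, \<nu>]"
    and dims: "dim {x. \<delta> x = \<kappa> *\<^sub>R x} = 1" "dim {x. \<delta> x = lam *\<^sub>R x} = 1"
      "dim {x. \<delta> x = \<mu> *\<^sub>R x} = 2" "dim {x. \<delta> x = \<nu> *\<^sub>R x} = 3"
    and d: "d = vector [\<nu>, \<nu>, \<nu>, \<mu>, \<mu>, lam, \<kappa>]"
begin

lemma linear_endo: "linear \<delta>"
  using \<delta> unfolding sym_endo_def by blast

lemma eigenvectors_orthogonal:
  "\<delta> x = l *\<^sub>R x \<Longrightarrow> \<delta> y = l' *\<^sub>R y \<Longrightarrow> l \<noteq> l' \<Longrightarrow> x \<bullet> y = 0"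
  by (rule sym_endo_eigenvectors_orthogonal[OF \<delta>])

lemma eigenvector_scale: "\<delta> x = l *\<^sub>R x \<Longrightarrow> \<delta> (a *\<^sub>R x) = l *\<^sub>R (a *\<^sub>R x)"
  by (simp add: linear_scale[OF linear_endo] mult.commute)

lemma eigenvector_add:
  "\<delta> x = l *\<^sub>R x \<Longrightarrow> \<delta> y = l *\<^sub>R y \<Longrightarrow> \<delta> (x + y) = l *\<^sub>R (x + y)"
  by (simp add: linear_add[OF linear_endo] scaleR_add_right)

lemma distinct_neqs: "\<kappa> \<noteq> lam" "\<kappa> \<noteq> \<mu>" "\<kappa> \<noteq> \<nu>" "lam \<noteq> \<mu>" "lam \<noteq> \<nu>" "\<mu> \<noteq> \<nu>"
  using distinct by auto

lemma eigenvector_exists: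
  assumes "finite B" "card B < dim {x. \<delta> x = l *\<^sub>R x}"
  shows "\<exists>x. norm x = 1 \<and> \<delta> x = l *\<^sub>R x \<and> (\<forall>b\<in>B. x \<bullet> b = 0)"
  using unit_vector_orthogonal_exists[OF subspace_eigenspace[OF linear_endo] assms] by auto

lemma lam_eigenvector_exists: "\<exists>x. norm x = 1 \<and> \<delta> x = lam *\<^sub>R x"
  using eigenvector_exists[of "{}" lam] dims(2) by auto

lemma kappa_eigenvector_exists: "\<exists>x. norm x = 1 \<and> \<delta> x = \<kappa> *\<^sub>R x"
  using eigenvector_exists[of "{}" \<kappa>] dims(1) by auto

lemma mu_eigenvector_exists: "\<exists>x. norm x = 1 \<and> \<delta> x = \<mu> *\<^sub>R x \<and> x \<bullet> y = 0"
  using eigenvector_exists[of "{y}" \<mu>] dims(3) by auto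

lemma nu_eigenvector_exists: "\<exists>x. norm x = 1 \<and> \<delta> x = \<nu> *\<^sub>R x \<and> x \<bullet> y = 0 \<and> x \<bullet> y' = 0"
proof -
  have "card {y, y'} < dim {x. \<delta> x = \<nu> *\<^sub>R x}"
    using dims(4) card_length[of "[y, y']"] by simp
  from eigenvector_exists[OF _ this] show ?thesis by auto
qed

lemma mu_eigenvectorI:
  assumes l0: "norm l0 = 1" "\<delta> l0 = lam *\<^sub>R l0" and k0: "norm k0 = 1" "\<delta> k0 = \<kappa> *\<^sub>R k0"
    and "x \<bullet> l0 = 0" "x \<bullet> k0 = 0" and N: "\<And>y. \<delta> y = \<nu> *\<^sub>R y \<Longrightarrow> x \<bullet> y = 0"
  shows "\<delta> x = \<mu> *\<^sub>R x"
proof (rule eigenspace_complement[OF \<delta>, of "{\<kappa>, lam, \<mu>, \<nu>}"])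
  show "(\<Sum>l\<in>{\<kappa>, lam, \<mu>, \<nu>}. dim {x. \<delta> x = l *\<^sub>R x}) = DIM('v)"
    using distinct dims dim7 by simp
next
  fix l y assume l: "l \<in> {\<kappa>, lam, \<mu>, \<nu>}" "l \<noteq> \<mu>" "\<delta> y = l *\<^sub>R y"
  have "y = (y \<bullet> l0) *\<^sub>R l0" if "l = lam"
    using unit_vector_spans_line[OF subspace_eigenspace[OF linear_endo] dims(2)] l0 l(3) that by simp
  moreover have "y = (y \<bullet> k0) *\<^sub>R k0" if "l = \<kappa>"
    using unit_vector_spans_line[OF subspace_eigenspace[OF linear_endo] dims(1)] k0 l(3) that by simp
  ultimately show "x \<bullet> y = 0"
    using l N assms(5,6) by (metis empty_iff insert_iff inner_scaleR_right mult_zero_right)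
qed auto

text \<open>Replacing (u, v, z) by (\<epsilon>u, \<tau>v, \<epsilon>\<tau>z) turns n, m, uz, vz, f into \<epsilon>\<tau>n, \<epsilon>\<tau>m, \<tau>uz, \<epsilon>vz, f. A suitable \<epsilon>
  moves the coordinates of the \<kappa>-eigenvector, and a suitable \<tau> those of the second
  \<mu>-eigenvector, into the first quadrant. If f itself belongs to \<kappa>, then \<phi> = 0 and the rotation in
  the plane of uz and vz is not restricted by k; the last assumption makes \<theta> = 0 possible.\<close>

lemma eigenframe_adjust_signs:
  fixes u v z :: 'v and \<alpha> :: real
  defines "w \<equiv> u \<star> v"
  defines "n \<equiv> cos \<alpha> *\<^sub>R w - sin \<alpha> *\<^sub>R z" and "m \<equiv> sin \<alpha> *\<^sub>R w + cos \<alpha> *\<^sub>R z" and "f \<equiv> w \<star> z"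
  assumes cayley: "cayley_triple (\<star>) (u, v, z)"
    and uvn: "\<delta> u = \<nu> *\<^sub>R u" "\<delta> v = \<nu> *\<^sub>R v" "\<delta> n = \<nu> *\<^sub>R n" and m: "\<delta> m = \<mu> *\<^sub>R m"
    and k0: "norm k0 = 1" "\<delta> k0 = \<kappa> *\<^sub>R k0" "k0 \<bullet> (u \<star> z) = 0"
    and f: "\<delta> f = \<kappa> *\<^sub>R f \<Longrightarrow> \<delta> (u \<star> z) = \<mu> *\<^sub>R (u \<star> z)"
  shows "\<exists>t \<theta> \<phi>. cayley_triple (\<star>) t \<and>
    (0 \<le> \<theta> \<and> \<theta> \<le> pi / 2 \<and> 0 < \<phi> \<and> \<phi> \<le> pi / 2 \<or> \<theta> = 0 \<and> \<phi> = 0) \<and>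
    (\<forall>i. \<delta> (eigenframe t \<alpha> \<theta> \<phi> $ i) = d $ i *\<^sub>R eigenframe t \<alpha> \<theta> \<phi> $ i)"
proof -
  note frame = dim7 cayley w_def[THEN meta_eq_to_obj_eq] n_def[THEN meta_eq_to_obj_eq]
    m_def[THEN meta_eq_to_obj_eq] f_def[THEN meta_eq_to_obj_eq]
  note expand = frame_expand[OF frame]
  note normal = plane_normal_inner[OF frame]
  note inn = cayley_inner_generators[OF cayley w_def[THEN meta_eq_to_obj_eq]]
    cayley_inner_products[OF cayley w_def[THEN meta_eq_to_obj_eq]]
  have fi: "(u \<star> z) \<bullet> f = 0" "(v \<star> z) \<bullet> f = 0"
    using normal by (simp_all add: inner_commute)
  have "k0 \<bullet> u = 0" "k0 \<bullet> v = 0" "k0 \<bullet> n = 0" "k0 \<bullet> m = 0"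
    using eigenvectors_orthogonal[OF k0(2)] uvn m distinct_neqs by blast+
  then have k0_eq: "k0 = (k0 \<bullet> (v \<star> z)) *\<^sub>R (v \<star> z) + (k0 \<bullet> f) *\<^sub>R f"
    using expand[of k0] k0(3) by simp
  have "(k0 \<bullet> (v \<star> z))\<^sup>2 + (k0 \<bullet> f)\<^sup>2 = 1"
    using k0(1) arg_cong[OF k0_eq, of "\<lambda>x. k0 \<bullet> x"]
    by (simp add: norm_eq_1 inner_right_distrib power2_eq_square)
  then obtain \<phi> \<epsilon> \<sigma> where \<phi>: "0 \<le> \<phi>" "\<phi> \<le> pi / 2" and sgn: "\<epsilon> \<in> {1, -1}" "\<sigma> \<in> {1, -1}"
    and k0_coord: "k0 \<bullet> (v \<star> z) = \<sigma> * \<epsilon> * sin \<phi>" "k0 \<bullet> f = \<sigma> * cos \<phi>"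
    by (rule unit_circle_first_quadrant)
  have sgn2: "\<epsilon> * \<epsilon> = 1" "\<sigma> * \<sigma> = 1" using sgn by auto
  \<comment> \<open>The \<kappa>-eigenvector up to sign, written in the basis to be constructed.\<close>
  define k where "k = (\<epsilon> * sin \<phi>) *\<^sub>R (v \<star> z) + cos \<phi> *\<^sub>R f"
  have "k = \<sigma> *\<^sub>R k0"
    using k0_eq unfolding k0_coord k_def using sgn2 by (metis (no_types, lifting) mult.assoc mult_1 scaleR_add_right scaleR_scaleR)
  then have k: "\<delta> k = \<kappa> *\<^sub>R k" using eigenvector_scale[OF k0(2)] by simp
  \<comment> \<open>The unit vector in the plane of vz and f orthogonal to k; together with uz it spans the plane of m' and l.\<close>
  define e where "e = sin \<phi> *\<^sub>R f - (\<epsilon> * cos \<phi>) *\<^sub>R (v \<star> z)"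
  obtain \<theta> \<tau> where \<theta>: "0 \<le> \<theta> \<and> \<theta> \<le> pi / 2 \<and> 0 < \<phi> \<and> \<phi> \<le> pi / 2 \<or> \<theta> = 0 \<and> \<phi> = 0"
    and \<tau>: "\<tau> \<in> {1, -1}"
    and m': "\<delta> ((\<tau> * cos \<theta>) *\<^sub>R (u \<star> z) + sin \<theta> *\<^sub>R e) = \<mu> *\<^sub>R ((\<tau> * cos \<theta>) *\<^sub>R (u \<star> z) + sin \<theta> *\<^sub>R e)"
  proof (cases "\<phi> = 0")
    case True
    then have "\<delta> f = \<kappa> *\<^sub>R f" using k by (simp add: k_def)
    \<comment> \<open>Here k = f, so uz is a \<mu>-eigenvector and no rotation is needed.\<close>
    from f[OF this] show thesis using that[of 0 1] True by simp
  next
    case False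
    obtain m' where m': "norm m' = 1" "\<delta> m' = \<mu> *\<^sub>R m'" "m' \<bullet> m = 0"
      using mu_eigenvector_exists by blast
    have "m' \<bullet> u = 0" "m' \<bullet> v = 0" "m' \<bullet> n = 0" and m'k: "m' \<bullet> k = 0"
      using eigenvectors_orthogonal[OF m'(2)] uvn k distinct_neqs by metis+
    define p r s where "p = m' \<bullet> (u \<star> z)" and "r = m' \<bullet> (v \<star> z)" and "s = m' \<bullet> f"
    have m'_eq: "m' = p *\<^sub>R (u \<star> z) + r *\<^sub>R (v \<star> z) + s *\<^sub>R f"
      using expand[of m'] \<open>m' \<bullet> u = 0\<close> \<open>m' \<bullet> v = 0\<close> \<open>m' \<bullet> n = 0\<close> m'(3) by (simp add: p_def r_def s_def)
    have rs: "s * cos \<phi> = - (r * \<epsilon> * sin \<phi>)"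
      using m'k by (simp add: k_def inner_right_distrib r_def s_def algebra_simps)
    define q where "q = s * sin \<phi> - r * \<epsilon> * cos \<phi>"
    have sc: "sin \<phi> * sin \<phi> = 1 - cos \<phi> * cos \<phi>"
      using sin_cos_squared_add3[of \<phi>] by linarith
    have q1: "q * sin \<phi> = s"
      using q_def rs sc by algebra
    have q2: "q * (\<epsilon> * cos \<phi>) = - r"
      using q_def rs sgn2 sc by algebra
    have m'_pq: "m' = p *\<^sub>R (u \<star> z) + q *\<^sub>R e"
      unfolding m'_eq e_def by (simp add: scaleR_diff_right q1 q2)
    have "p\<^sup>2 + q\<^sup>2 = 1"
    proof -
      have "1 = p * p + r * r + s * s"
        using m'(1) arg_cong[OF m'_eq, of "\<lambda>x. m' \<bullet> x"]
        by (simp add: norm_eq_1 inner_right_distrib p_def r_def s_def)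
      also have "r * r + s * s = q * q"
      proof -
        have "r * r + s * s = (q * (\<epsilon> * cos \<phi>)) * (q * (\<epsilon> * cos \<phi>)) + (q * sin \<phi>) * (q * sin \<phi>)"
          unfolding q1 q2 by simp
        also have "\<dots> = q * q * ((\<epsilon> * \<epsilon>) * (cos \<phi> * cos \<phi>) + sin \<phi> * sin \<phi>)"
          by (simp add: algebra_simps)
        finally show ?thesis using sgn2 sc by simp
      qed
      then have "p * p + r * r + s * s = p * p + q * q" by simp
      finally show ?thesis by (simp add: power2_eq_square)
    qed
    then obtain t \<tau> \<rho> where t: "0 \<le> t" "t \<le> pi / 2" "\<tau> \<in> {1, -1}" "\<rho> \<in> {1, -1}"
      "p = \<rho> * \<tau> * sin t" "q = \<rho> * cos t"
      by (rule unit_circle_first_quadrant)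
    \<comment> \<open>The quadrant lemma puts the sign on the sine, here it belongs to the cosine: use the complementary angle.\<close>
    have "(\<tau> * cos (pi / 2 - t)) *\<^sub>R (u \<star> z) + sin (pi / 2 - t) *\<^sub>R e = \<rho> *\<^sub>R m'"
      unfolding m'_pq using t by (auto simp: cos_diff sin_diff)
    moreover have "0 < \<phi>" using False \<phi> by simp
    ultimately show thesis
      using that[of "pi / 2 - t" \<tau>] eigenvector_scale[OF m'(2), of \<rho>] t \<phi> by simp
  qed
  define t where "t = (\<epsilon> *\<^sub>R u, \<tau> *\<^sub>R v, (\<epsilon> * \<tau>) *\<^sub>R z)"
  have tau2: "\<tau> * \<tau> = 1" using \<tau> by auto
  have prods: "(\<epsilon> *\<^sub>R u) \<star> (\<tau> *\<^sub>R v) = (\<epsilon> * \<tau>) *\<^sub>R w" "(\<epsilon> *\<^sub>R u) \<star> ((\<epsilon> * \<tau>) *\<^sub>R z) = \<tau> *\<^sub>R (u \<star> z)"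
    "(\<tau> *\<^sub>R v) \<star> ((\<epsilon> * \<tau>) *\<^sub>R z) = \<epsilon> *\<^sub>R (v \<star> z)" "((\<epsilon> * \<tau>) *\<^sub>R w) \<star> ((\<epsilon> * \<tau>) *\<^sub>R z) = f"
    using sgn(1) \<tau> by (auto simp: vprod_simps w_def f_def)
  have ct: "cayley_triple (\<star>) t"
    unfolding t_def cayley_triple_iff prods using sgn(1) \<tau> by (auto simp: inn)
  let ?c = "eigenframe t \<alpha> \<theta> \<phi>"
  have eig: "\<delta> (?c $ i) = d $ i *\<^sub>R ?c $ i" if "i \<noteq> 6" for i
  proof -
    have "?c $ 1 = \<epsilon> *\<^sub>R u" "?c $ 2 = \<tau> *\<^sub>R v" "?c $ 3 = (\<epsilon> * \<tau>) *\<^sub>R n" "?c $ 4 = (\<epsilon> * \<tau>) *\<^sub>R m"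
      "?c $ 7 = k"
      unfolding t_def eigenframe_nth prods n_def m_def k_def
      by (simp_all add: algebra_simps)
    moreover have "?c $ 5 = (\<tau> * cos \<theta>) *\<^sub>R (u \<star> z) + sin \<theta> *\<^sub>R e"
      unfolding t_def eigenframe_nth prods e_def by (simp add: algebra_simps)
    ultimately show ?thesis
      using exhaust_7[of i] that eigenvector_scale uvn m k m' unfolding d by auto
  qed
  obtain l0 where l0: "norm l0 = 1" "\<delta> l0 = lam *\<^sub>R l0" using lam_eigenvector_exists by blast
  have card: "DIM('v) = CARD(7)" using dim7 by simp
  have "\<delta> (?c $ 6) = d $ 6 *\<^sub>R ?c $ 6"
  proof (rule orthonormal_family_last_eigenvector[OF \<delta> eigenframe_orthonormal[OF ct] card])
    show "d $ i \<noteq> d $ 6" if "i \<noteq> 6" for i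
      using exhaust_7[of i] that distinct_neqs unfolding d by auto
    show "l0 \<noteq> 0" "\<delta> l0 = d $ 6 *\<^sub>R l0" using l0 unfolding d by auto
  qed (rule eig)
  then have "\<delta> (?c $ i) = d $ i *\<^sub>R ?c $ i" for i using eig[of i] by (cases "i = 6") simp_all
  then show ?thesis using ct \<theta> by blast
qed

text \<open>If N contains an orthonormal pair a, b together with the product ab, then a, b, ab is a basis of N
  closed under the product, and multiplication by a \<mu>-eigenvector z maps N onto the complement of
  N and z. Preimages of the second \<mu>-eigenvector and of the \<lambda>-eigenvector serve as u and v.\<close>

lemma eigenframe_associative:
  fixes a b :: 'v
  assumes ab: "a \<bullet> a = 1" "b \<bullet> b = 1" "a \<bullet> b = 0"
    and N: "\<delta> a = \<nu> *\<^sub>R a" "\<delta> b = \<nu> *\<^sub>R b" "\<delta> (a \<star> b) = \<nu> *\<^sub>R (a \<star> b)"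
  shows "\<exists>t. cayley_triple (\<star>) t \<and> (\<forall>i. \<delta> (eigenframe t 0 0 0 $ i) = d $ i *\<^sub>R eigenframe t 0 0 0 $ i)"
proof -
  define c where "c = a \<star> b"
  obtain z where z: "norm z = 1" "\<delta> z = \<mu> *\<^sub>R z"
    using mu_eigenvector_exists[of 0] by blast
  obtain m where m: "norm m = 1" "\<delta> m = \<mu> *\<^sub>R m" "m \<bullet> z = 0"
    using mu_eigenvector_exists by blast
  obtain l where l: "norm l = 1" "\<delta> l = lam *\<^sub>R l" using lam_eigenvector_exists by blast
  obtain k where k: "norm k = 1" "\<delta> k = \<kappa> *\<^sub>R k" using kappa_eigenvector_exists by blast
  have zN: "a \<bullet> z = 0" "b \<bullet> z = 0" "(a \<star> b) \<bullet> z = 0"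
    using eigenvectors_orthogonal[OF _ z(2)] N distinct_neqs by metis+
  have cayley: "cayley_triple (\<star>) (a, b, z)"
    unfolding cayley_triple_iff using ab z zN by (simp add: norm_eq_1)
  note gen = cayley_inner_generators[OF cayley c_def]
  note inn = cayley_inner_products[OF cayley c_def]
  note quat = cayley_quaternion_table[OF cayley c_def]
  \<comment> \<open>Vectors orthogonal to N and z have the form pz with p in N.\<close>
  have solve: "\<exists>p. \<delta> p = \<nu> *\<^sub>R p \<and> p \<bullet> z = 0 \<and> x = p \<star> z \<and> (\<exists>p1 p2 p3. p = p1 *\<^sub>R a + p2 *\<^sub>R b + p3 *\<^sub>R c)"
    if x: "x \<bullet> a = 0" "x \<bullet> b = 0" "x \<bullet> c = 0" "x \<bullet> z = 0" for x
  proof -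
    define p1 p2 p3 where "p1 = x \<bullet> (a \<star> z)" and "p2 = x \<bullet> (b \<star> z)" and "p3 = x \<bullet> (c \<star> z)"
    define p where "p = p1 *\<^sub>R a + p2 *\<^sub>R b + p3 *\<^sub>R c"
    have "x = p1 *\<^sub>R (a \<star> z) + p2 *\<^sub>R (b \<star> z) + p3 *\<^sub>R (c \<star> z)"
      using frame_expand[OF dim7 cayley c_def refl refl refl, of x 0] x
      by (simp add: p1_def p2_def p3_def)
    then have "x = p \<star> z" by (simp add: p_def vprod_simps)
    moreover have "\<delta> p = \<nu> *\<^sub>R p"
      unfolding p_def using N by (intro eigenvector_add eigenvector_scale) (simp_all add: c_def)
    moreover have "p \<bullet> z = 0" by (simp add: p_def inner_add_left gen)
    ultimately show ?thesis using p_def by blast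
  qed
  have mN: "m \<bullet> a = 0" "m \<bullet> b = 0" "m \<bullet> c = 0" and lN: "l \<bullet> a = 0" "l \<bullet> b = 0" "l \<bullet> c = 0"
    and lm: "l \<bullet> z = 0" "m \<bullet> l = 0"
    using eigenvectors_orthogonal[OF m(2)] eigenvectors_orthogonal[OF l(2)] N l(2) z(2) distinct_neqs
    unfolding c_def by metis+
  obtain u where u: "\<delta> u = \<nu> *\<^sub>R u" "u \<bullet> z = 0" "m = u \<star> z"
    and "\<exists>p1 p2 p3. u = p1 *\<^sub>R a + p2 *\<^sub>R b + p3 *\<^sub>R c"
    using solve[OF mN m(3)] by blast
  then obtain p1 p2 p3 where up: "u = p1 *\<^sub>R a + p2 *\<^sub>R b + p3 *\<^sub>R c" by blast
  obtain v where v: "\<delta> v = \<nu> *\<^sub>R v" "v \<bullet> z = 0" "l = v \<star> z"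
    and "\<exists>q1 q2 q3. v = q1 *\<^sub>R a + q2 *\<^sub>R b + q3 *\<^sub>R c"
    using solve[OF lN lm(1)] by blast
  then obtain q1 q2 q3 where vq: "v = q1 *\<^sub>R a + q2 *\<^sub>R b + q3 *\<^sub>R c" by blast
  have "u \<star> v = (p1 * q2 - p2 * q1) *\<^sub>R c + (p2 * q3 - p3 * q2) *\<^sub>R a + (p3 * q1 - p1 * q3) *\<^sub>R b"
    unfolding up vq by (simp add: vprod_simps quat algebra_simps)
  then have w: "\<delta> (u \<star> v) = \<nu> *\<^sub>R (u \<star> v)"
    using N by (auto intro!: eigenvector_add eigenvector_scale simp: c_def)
  have "u \<bullet> u = 1" "v \<bullet> v = 1" "u \<bullet> v = 0"
    using inn(1)[of u u] inn(1)[of v v] inn(1)[of u v] u v m(1) l(1) lm(2)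
    by (simp_all add: norm_eq_1 inner_commute)
  moreover have "(u \<star> v) \<bullet> z = 0" using eigenvectors_orthogonal[OF w z(2)] distinct_neqs by blast
  ultimately have t: "cayley_triple (\<star>) (u, v, z)"
    unfolding cayley_triple_iff using u v z by (simp add: norm_eq_1)
  let ?c = "eigenframe (u, v, z) 0 0 0"
  have card: "DIM('v) = CARD(7)" using dim7 by simp
  have eig: "\<delta> (?c $ i) = d $ i *\<^sub>R ?c $ i" if "i \<noteq> 7" for i
  proof -
    have "?c $ 1 = u" "?c $ 2 = v" "?c $ 3 = u \<star> v" "?c $ 4 = z" "?c $ 5 = m" "?c $ 6 = l"
      unfolding eigenframe_nth u(3) v(3) by simp_all
    then show ?thesis using exhaust_7[of i] that u v w z m l unfolding d by auto
  qed
  have "\<delta> (?c $ 7) = d $ 7 *\<^sub>R ?c $ 7"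
  proof (rule orthonormal_family_last_eigenvector[OF \<delta> eigenframe_orthonormal[OF t] card])
    show "d $ i \<noteq> d $ 7" if "i \<noteq> 7" for i
      using exhaust_7[of i] that distinct_neqs unfolding d by auto
    show "k \<noteq> 0" "\<delta> k = d $ 7 *\<^sub>R k" using k unfolding d by auto
  qed (rule eig)
  then have "\<delta> (?c $ i) = d $ i *\<^sub>R ?c $ i" for i using eig[of i] by (cases "i = 7") simp_all
  then show ?thesis using t by blast
qed

lemma nu_eigenspace_basis:
  "\<exists>a b c. (\<delta> a = \<nu> *\<^sub>R a \<and> \<delta> b = \<nu> *\<^sub>R b \<and> \<delta> c = \<nu> *\<^sub>R c) \<and>
    (\<forall>x. \<delta> x = \<nu> *\<^sub>R x \<longrightarrow> (\<exists>p q r. x = p *\<^sub>R a + q *\<^sub>R b + r *\<^sub>R c))"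
proof -
  obtain B where B: "B \<subseteq> {x. \<delta> x = \<nu> *\<^sub>R x}" "independent B" "{x. \<delta> x = \<nu> *\<^sub>R x} \<subseteq> span B"
    "card B = dim {x. \<delta> x = \<nu> *\<^sub>R x}"
    using basis_exists by blast
  then obtain a b c where abc: "B = {a, b, c}"
    using dims(4) by (auto simp: card_3_iff)
  have "\<exists>p q r. x = p *\<^sub>R a + q *\<^sub>R b + r *\<^sub>R c" if "\<delta> x = \<nu> *\<^sub>R x" for x
  proof -
    have "x \<in> span {a, b, c}" using that B(3) abc by blast
    then obtain p q r where "x - p *\<^sub>R a - q *\<^sub>R b = r *\<^sub>R c"
      by (auto simp: span_breakdown_eq span_singleton)
    then have "x = p *\<^sub>R a + q *\<^sub>R b + r *\<^sub>R c" by (simp add: algebra_simps)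
    then show ?thesis by blast
  qed
  then show ?thesis using B(1) abc by blast
qed

text \<open>Three basis vectors of N and their three products do not span the seven-dimensional space.\<close>

lemma plane_normal_exists:
  "\<exists>f. norm f = 1 \<and> (\<forall>x. \<delta> x = \<nu> *\<^sub>R x \<longrightarrow> f \<bullet> x = 0) \<and>
    (\<forall>x y. \<delta> x = \<nu> *\<^sub>R x \<longrightarrow> \<delta> y = \<nu> *\<^sub>R y \<longrightarrow> f \<bullet> (x \<star> y) = 0)"
proof -
  obtain a b c where abc: "\<delta> a = \<nu> *\<^sub>R a" "\<delta> b = \<nu> *\<^sub>R b" "\<delta> c = \<nu> *\<^sub>R c"
    and span: "\<And>x. \<delta> x = \<nu> *\<^sub>R x \<Longrightarrow> \<exists>p q r. x = p *\<^sub>R a + q *\<^sub>R b + r *\<^sub>R c"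
    using nu_eigenspace_basis by metis
  let ?L = "[a, b, c, a \<star> b, a \<star> c, b \<star> c]"
  have "card (set ?L) < dim (UNIV :: 'v set)"
    using card_length[of ?L] dim7 by (simp del: set_simps add: dim_UNIV)
  then obtain f where f: "norm f = 1" "\<forall>x\<in>set ?L. f \<bullet> x = 0"
    using unit_vector_orthogonal_exists[OF subspace_UNIV, of "set ?L"] by auto
  have f1: "f \<bullet> x = 0" if "\<delta> x = \<nu> *\<^sub>R x" for x
    using span[OF that] f(2) by (auto simp: inner_add_right)
  moreover have "f \<bullet> (x \<star> y) = 0" if x: "\<delta> x = \<nu> *\<^sub>R x" and y: "\<delta> y = \<nu> *\<^sub>R y" for x y
  proof -
    obtain p q r p' q' r' where xy: "x = p *\<^sub>R a + q *\<^sub>R b + r *\<^sub>R c" "y = p' *\<^sub>R a + q' *\<^sub>R b + r' *\<^sub>R c"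
      using span[OF x] span[OF y] by blast
    have "b \<star> a = - (a \<star> b)" "c \<star> a = - (a \<star> c)" "c \<star> b = - (b \<star> c)"
      by (rule vprod_anticommute)+
    then show ?thesis
      unfolding xy using f(2) by (simp add: vprod_simps inner_add_right inner_diff_right)
  qed
  ultimately show ?thesis using f(1) by blast
qed

text \<open>All vectors of N are found by imposing two linear conditions on a three-dimensional space.\<close>

lemma eigenframe_nonassociative:
  assumes nonassoc: "\<And>a b. a \<bullet> a = 1 \<Longrightarrow> b \<bullet> b = 1 \<Longrightarrow> a \<bullet> b = 0 \<Longrightarrow> \<delta> a = \<nu> *\<^sub>R a \<Longrightarrow> \<delta> b = \<nu> *\<^sub>R b \<Longrightarrow>
      \<delta> (a \<star> b) \<noteq> \<nu> *\<^sub>R (a \<star> b)"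
  shows "\<exists>t \<alpha> \<theta> \<phi>. cayley_triple (\<star>) t \<and> 0 < \<alpha> \<and> \<alpha> \<le> pi / 2 \<and>
    (0 \<le> \<theta> \<and> \<theta> \<le> pi / 2 \<and> 0 < \<phi> \<and> \<phi> \<le> pi / 2 \<or> \<theta> = 0 \<and> \<phi> = 0) \<and>
    (\<forall>i. \<delta> (eigenframe t \<alpha> \<theta> \<phi> $ i) = d $ i *\<^sub>R eigenframe t \<alpha> \<theta> \<phi> $ i)"
proof -
  obtain f where f: "norm f = 1" "\<And>x. \<delta> x = \<nu> *\<^sub>R x \<Longrightarrow> f \<bullet> x = 0"
    "\<And>x y. \<delta> x = \<nu> *\<^sub>R x \<Longrightarrow> \<delta> y = \<nu> *\<^sub>R y \<Longrightarrow> f \<bullet> (x \<star> y) = 0"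
    using plane_normal_exists by metis
  obtain l where l: "norm l = 1" "\<delta> l = lam *\<^sub>R l" using lam_eigenvector_exists by blast
  obtain k where k: "norm k = 1" "\<delta> k = \<kappa> *\<^sub>R k" using kappa_eigenvector_exists by blast
  have shift: "(x \<star> f) \<bullet> y = x \<bullet> (f \<star> y)" for x y by (rule vprod_inner_shift)
  have mu: "\<delta> (x \<star> f) = \<mu> *\<^sub>R (x \<star> f)"
    if "\<delta> x = \<nu> *\<^sub>R x" "x \<bullet> (f \<star> l) = 0" "x \<bullet> (f \<star> k) = 0" for x
  proof (rule mu_eigenvectorI[OF l k])
    show "(x \<star> f) \<bullet> l = 0" "(x \<star> f) \<bullet> k = 0" using that by (simp_all add: shift)
    show "(x \<star> f) \<bullet> y = 0" if y: "\<delta> y = \<nu> *\<^sub>R y" for y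
      using f(3)[OF y \<open>\<delta> x = \<nu> *\<^sub>R x\<close>] vprod_inner_rotate[of x f y] by (simp add: vprod_inner_shift)
  qed
  \<comment> \<open>These two conditions make nf a \<mu>-eigenvector; it will be m up to sign.\<close>
  obtain n where n: "norm n = 1" "\<delta> n = \<nu> *\<^sub>R n" "n \<bullet> (f \<star> l) = 0" "n \<bullet> (f \<star> k) = 0"
    using nu_eigenvector_exists by blast
  \<comment> \<open>If f belongs to \<kappa>, then vf is orthogonal to k for any v, and the free condition makes vf a \<mu>-eigenvector.\<close>
  obtain v where v: "norm v = 1" "\<delta> v = \<nu> *\<^sub>R v" "v \<bullet> n = 0"
    and vf: "v \<bullet> (if \<delta> f = \<kappa> *\<^sub>R f then f \<star> l else f \<star> k) = 0"
    using nu_eigenvector_exists by blast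
  have vk: "v \<bullet> (f \<star> k) = 0"
  proof (cases "\<delta> f = \<kappa> *\<^sub>R f")
    case True
    have "f = (f \<bullet> k) *\<^sub>R k"
      using unit_vector_spans_line[OF subspace_eigenspace[OF linear_endo] dims(1)] k True by simp
    then have "f \<star> k = 0" by (metis vprod_simps(5) vprod_self scaleR_zero_right)
    then show ?thesis by simp
  qed (use vf in simp)
  obtain u' where u': "norm u' = 1" "\<delta> u' = \<nu> *\<^sub>R u'" "u' \<bullet> n = 0" "u' \<bullet> v = 0"
    using nu_eigenvector_exists by blast
  \<comment> \<open>The sign of u makes cos \<alpha> nonnegative.\<close>
  define u where "u = (if 0 \<le> (u' \<star> v) \<bullet> n then u' else - u')"
  have "\<delta> (- u') = \<nu> *\<^sub>R (- u')" using eigenvector_scale[OF u'(2), of "-1"] by simp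
  then have u: "norm u = 1" "\<delta> u = \<nu> *\<^sub>R u" "u \<bullet> n = 0" "u \<bullet> v = 0" "0 \<le> (u \<star> v) \<bullet> n"
    using u' by (auto simp: u_def vprod_simps)
  define w where "w = u \<star> v"
  define c where "c = w \<bullet> n"
  have ww: "w \<bullet> w = 1" using u v unfolding w_def vprod_inner_self by (simp add: norm_eq_1)
  have wuv: "w \<bullet> u = 0" "w \<bullet> v = 0" by (simp_all add: w_def)
  \<comment> \<open>Hence cos \<alpha> < 1, so \<alpha> is positive and z is obtained by solving the definition of n.\<close>
  have "w \<noteq> n"
    using nonassoc[of u v] u v n(2) by (auto simp: w_def norm_eq_1)
  then have "0 < (w - n) \<bullet> (w - n)" by simp
  also have "(w - n) \<bullet> (w - n) = 2 - 2 * c"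
    using ww n(1) by (simp add: inner_simps norm_eq_1 c_def inner_commute)
  finally have c: "0 \<le> c" "c < 1" using u(5) by (simp_all add: c_def w_def)
  define \<alpha> where "\<alpha> = arccos c"
  have cos: "cos \<alpha> = c" using c by (simp add: \<alpha>_def)
  have \<alpha>: "0 < \<alpha>" "\<alpha> \<le> pi / 2"
    using c arccos_lt_bounded[of c] arccos_le_pi2[of c] by (simp_all add: \<alpha>_def)
  then have sin: "0 < sin \<alpha>" using pi_gt_zero by (intro sin_gt_zero) linarith+
  define z where "z = (1 / sin \<alpha>) *\<^sub>R (c *\<^sub>R w - n)"
  have n_eq: "n = cos \<alpha> *\<^sub>R w - sin \<alpha> *\<^sub>R z" using sin by (simp add: z_def cos)
  have cayley: "cayley_triple (\<star>) (u, v, z)"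
    unfolding cayley_triple_iff w_def[symmetric]
  proof (intro conjI)
    show "u \<bullet> u = 1" "v \<bullet> v = 1" "u \<bullet> v = 0" using u v by (simp_all add: norm_eq_1)
    show "u \<bullet> z = 0" "v \<bullet> z = 0" "w \<bullet> z = 0"
      using u v wuv ww by (simp_all add: z_def inner_simps inner_commute[of u w]
          inner_commute[of v w] c_def)
    have "(c *\<^sub>R w - n) \<bullet> (c *\<^sub>R w - n) = (sin \<alpha>)\<^sup>2"
      using ww n(1) by (simp add: inner_simps norm_eq_1 inner_commute[of n w] sin_squared_eq cos
          flip: c_def) (simp add: power2_eq_square)
    then show "z \<bullet> z = 1" using sin by (simp add: z_def power2_eq_square)
  qed
  note frame = dim7 cayley w_def n_eq refl refl
  have sgn: "f = w \<star> z \<or> f = - (w \<star> z)"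
    using sin f u v n by (intro plane_normal_unique[OF frame]) (simp_all add: norm_eq_1 w_def)
  have vprod_f: "n \<star> (w \<star> z) = - (sin \<alpha> *\<^sub>R w + cos \<alpha> *\<^sub>R z)" "v \<star> (w \<star> z) = - (u \<star> z)"
    by (rule plane_normal_vprod[OF frame])+
  have neg: "\<delta> (- x) = \<mu> *\<^sub>R (- x) \<longleftrightarrow> \<delta> x = \<mu> *\<^sub>R x" for x
    by (simp add: linear_neg[OF linear_endo])
  have "\<delta> (sin \<alpha> *\<^sub>R w + cos \<alpha> *\<^sub>R z) = \<mu> *\<^sub>R (sin \<alpha> *\<^sub>R w + cos \<alpha> *\<^sub>R z)"
    using mu[OF n(2-4)] sgn vprod_f(1) by (metis vprod_simps(8) neg minus_minus)
  moreover have "k \<bullet> (u \<star> z) = 0"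
    using vk sgn vprod_f(2) shift[of v k] by (metis vprod_simps(8) inner_commute inner_minus_left minus_minus neg_equal_0_iff_equal)
  moreover have "\<delta> (u \<star> z) = \<mu> *\<^sub>R (u \<star> z)" if "\<delta> (w \<star> z) = \<kappa> *\<^sub>R (w \<star> z)"
  proof -
    have "\<delta> f = \<kappa> *\<^sub>R f" using sgn that by (auto simp: linear_neg[OF linear_endo])
    then have "v \<bullet> (f \<star> l) = 0" using vf by simp
    then have "\<delta> (v \<star> f) = \<mu> *\<^sub>R (v \<star> f)" using mu v(2) vk by blast
    then show ?thesis using sgn vprod_f(2) by (metis vprod_simps(8) neg minus_minus)
  qed
  ultimately show ?thesis
    using eigenframe_adjust_signs[OF cayley u(2) v(2), of \<alpha> k] n(2) n_eq k \<alpha> unfolding w_def by metis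
qed

lemma eigenframe_exists:
  "\<exists>t \<alpha> \<theta> \<phi>. cayley_triple (\<star>) t \<and>
    (\<alpha>, \<theta>, \<phi>) \<in> ({0<..pi/2} \<times> {0..pi/2} \<times> {0<..pi/2}) \<union> ({0<..pi/2} \<times> {(0, 0)}) \<union> {(0, 0, 0)} \<and>
    (\<forall>i. \<delta> (eigenframe t \<alpha> \<theta> \<phi> $ i) = d $ i *\<^sub>R eigenframe t \<alpha> \<theta> \<phi> $ i)"
proof (cases "\<exists>a b. a \<bullet> a = 1 \<and> b \<bullet> b = 1 \<and> a \<bullet> b = 0 \<and> \<delta> a = \<nu> *\<^sub>R a \<and> \<delta> b = \<nu> *\<^sub>R b \<and>
    \<delta> (a \<star> b) = \<nu> *\<^sub>R (a \<star> b)")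
  case True
  then obtain t where "cayley_triple (\<star>) t" "\<forall>i. \<delta> (eigenframe t 0 0 0 $ i) = d $ i *\<^sub>R eigenframe t 0 0 0 $ i"
    using eigenframe_associative by blast
  then show ?thesis by blast
next
  case False
  then obtain t \<alpha> \<theta> \<phi> where t: "cayley_triple (\<star>) t"
    "\<forall>i. \<delta> (eigenframe t \<alpha> \<theta> \<phi> $ i) = d $ i *\<^sub>R eigenframe t \<alpha> \<theta> \<phi> $ i"
    and range: "0 < \<alpha>" "\<alpha> \<le> pi / 2" "0 \<le> \<theta> \<and> \<theta> \<le> pi / 2 \<and> 0 < \<phi> \<and> \<phi> \<le> pi / 2 \<or> \<theta> = 0 \<and> \<phi> = 0"
    using eigenframe_nonassociative by blast
  from range have "(\<alpha>, \<theta>, \<phi>) \<in> ({0<..pi/2} \<times> {0..pi/2} \<times> {0<..pi/2}) \<union> ({0<..pi/2} \<times> {(0, 0)}) \<union> {(0, 0, 0)}"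
    by auto
  with t show ?thesis by blast
qed

end

end

section \<open>Uniqueness of the parameters\<close>

lemma eigenbasis_expand:
  fixes c :: "'v::euclidean_space^'n"
  assumes "\<delta> \<in> sym_endo" "orthonormal_family c" "DIM('v) = CARD('n)"
    and "\<And>i. \<delta> (c $ i) = d $ i *\<^sub>R c $ i" "\<delta> x = l *\<^sub>R x"
  shows "x = (\<Sum>i | d $ i = l. (x \<bullet> c $ i) *\<^sub>R c $ i)"
proof -
  have "x = (\<Sum>i\<in>UNIV. (x \<bullet> c $ i) *\<^sub>R c $ i)"
    by (rule orthonormal_family_expand[OF assms(2,3)])
  also have "\<dots> = (\<Sum>i | d $ i = l. (x \<bullet> c $ i) *\<^sub>R c $ i)"
    by (rule sum.mono_neutral_right)
      (auto simp: eigenbasis_inner_eq_0[OF assms(1), of c d x l] assms(4,5))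
  finally show ?thesis .
qed

lemma unit_multiple_eq_or_neg:
  fixes x y :: "'v::real_inner"
  assumes "x = c *\<^sub>R y" "x \<bullet> x = 1" "y \<bullet> y = 1"
  shows "x = y \<or> x = - y"
proof -
  have "c * c = 1" using assms by simp
  then have "c = 1 \<or> c = -1" by (simp add: square_eq_1_iff)
  then show ?thesis using assms(1) by auto
qed

context cross_product
begin

context
  fixes \<delta> :: "'v \<Rightarrow> 'v" and \<kappa> lam \<mu> \<nu> :: real and d :: "real^7"
  assumes dim7: "DIM('v) = 7" and \<delta>: "\<delta> \<in> sym_endo" and distinct: "distinct [\<kappa>, lam, \<mu>, \<nu>]"
    and d: "d = vector [\<nu>, \<nu>, \<nu>, \<mu>, \<mu>, lam, \<kappa>]"
begin

lemma eigenframe_nu_expand: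
  assumes "cayley_triple (\<star>) (u, v, z)" and n: "n = cos \<alpha> *\<^sub>R (u \<star> v) - sin \<alpha> *\<^sub>R z"
    and eig: "\<And>i. \<delta> (eigenframe (u, v, z) \<alpha> \<theta> \<phi> $ i) = d $ i *\<^sub>R eigenframe (u, v, z) \<alpha> \<theta> \<phi> $ i"
    and x: "\<delta> x = \<nu> *\<^sub>R x"
  shows "x = (x \<bullet> u) *\<^sub>R u + (x \<bullet> v) *\<^sub>R v + (x \<bullet> n) *\<^sub>R n"
proof -
  have card: "DIM('v) = CARD(7)" using dim7 by simp
  have "{i. d $ i = \<nu>} = {1, 2, 3}"
    unfolding set_eq_iff forall_7 using distinct by (auto simp: d)
  then show ?thesis
    using eigenbasis_expand[OF \<delta> eigenframe_orthonormal[OF assms(1)] card eig x]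
    by (simp add: eigenframe_nth n add.assoc)
qed

text \<open>The hypothesis on j says that the eigenvalue is simple, so its eigenspace is a line containing the
  j-th vector of either frame.\<close>

lemma eigenframe_line_unique:
  assumes t: "cayley_triple (\<star>) t" and t': "cayley_triple (\<star>) t'"
    and eig: "\<And>i. \<delta> (eigenframe t \<alpha> \<theta> \<phi> $ i) = d $ i *\<^sub>R eigenframe t \<alpha> \<theta> \<phi> $ i"
    and eig': "\<And>i. \<delta> (eigenframe t' \<alpha>' \<theta>' \<phi>' $ i) = d $ i *\<^sub>R eigenframe t' \<alpha>' \<theta>' \<phi>' $ i"
    and j: "{i. d $ i = d $ j} = {j}"
  shows "eigenframe t' \<alpha>' \<theta>' \<phi>' $ j = eigenframe t \<alpha> \<theta> \<phi> $ j \<or>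
    eigenframe t' \<alpha>' \<theta>' \<phi>' $ j = - eigenframe t \<alpha> \<theta> \<phi> $ j"
proof -
  let ?c = "eigenframe t \<alpha> \<theta> \<phi>" and ?c' = "eigenframe t' \<alpha>' \<theta>' \<phi>'"
  have card: "DIM('v) = CARD(7)" using dim7 by simp
  have "?c' $ j = (?c' $ j \<bullet> ?c $ j) *\<^sub>R ?c $ j"
    using eigenbasis_expand[OF \<delta> eigenframe_orthonormal[OF t] card eig eig'[of j]] j by simp
  then show ?thesis
    by (rule unit_multiple_eq_or_neg)
      (simp_all add: orthonormal_familyD[OF eigenframe_orthonormal[OF t]]
        orthonormal_familyD[OF eigenframe_orthonormal[OF t']])
qed

context
  fixes u v z u' v' z' :: 'v and \<alpha> \<theta> \<phi> \<alpha>' \<theta>' \<phi>' :: real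
  assumes t: "cayley_triple (\<star>) (u, v, z)" and t': "cayley_triple (\<star>) (u', v', z')"
    and eig: "\<And>i. \<delta> (eigenframe (u, v, z) \<alpha> \<theta> \<phi> $ i) = d $ i *\<^sub>R eigenframe (u, v, z) \<alpha> \<theta> \<phi> $ i"
    and eig': "\<And>i. \<delta> (eigenframe (u', v', z') \<alpha>' \<theta>' \<phi>' $ i) = d $ i *\<^sub>R eigenframe (u', v', z') \<alpha>' \<theta>' \<phi>' $ i"
begin

text \<open>The coordinates of w' = u'v' with respect to u, v, n are cos \<alpha> times those of a cross product of
  orthonormal vectors, so by Lagrange's identity their squares add up to the square of cos \<alpha>. On the
  other hand the projection of w' to N is cos \<alpha>' n'.\<close>

lemma eigenframe_cos_square_unique: "(cos \<alpha>)\<^sup>2 = (cos \<alpha>')\<^sup>2"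
proof -
  define w n m where "w = u \<star> v" and "n = cos \<alpha> *\<^sub>R w - sin \<alpha> *\<^sub>R z" and "m = sin \<alpha> *\<^sub>R w + cos \<alpha> *\<^sub>R z"
  define w' n' m' where "w' = u' \<star> v'" and "n' = cos \<alpha>' *\<^sub>R w' - sin \<alpha>' *\<^sub>R z'"
    and "m' = sin \<alpha>' *\<^sub>R w' + cos \<alpha>' *\<^sub>R z'"
  note frame' = dim7 t' w'_def n'_def m'_def refl
  have nu: "\<delta> u = \<nu> *\<^sub>R u" "\<delta> v = \<nu> *\<^sub>R v" "\<delta> n = \<nu> *\<^sub>R n"
    using eig[of 1] eig[of 2] eig[of 3] by (simp_all add: eigenframe_nth d n_def w_def)
  have nu': "\<delta> u' = \<nu> *\<^sub>R u'" "\<delta> v' = \<nu> *\<^sub>R v'" "\<delta> n' = \<nu> *\<^sub>R n'" and mu': "\<delta> m' = \<mu> *\<^sub>R m'"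
    using eig'[of 1] eig'[of 2] eig'[of 3] eig'[of 4]
    by (simp_all add: eigenframe_nth d n'_def m'_def w'_def)
  have expand: "x = (x \<bullet> u) *\<^sub>R u + (x \<bullet> v) *\<^sub>R v + (x \<bullet> n) *\<^sub>R n" if "\<delta> x = \<nu> *\<^sub>R x" for x
    by (rule eigenframe_nu_expand[OF t _ eig that]) (simp add: n_def w_def)
  have parseval: "x \<bullet> y = (x \<bullet> u) * (y \<bullet> u) + (x \<bullet> v) * (y \<bullet> v) + (x \<bullet> n) * (y \<bullet> n)"
    if "\<delta> x = \<nu> *\<^sub>R x" for x y
    using arg_cong[OF expand[OF that], of "\<lambda>x. x \<bullet> y"]
    by (simp add: inner_add_left inner_add_right inner_commute[of _ y])
  have "\<mu> \<noteq> \<nu>" using distinct by auto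
  then have m'N: "m' \<bullet> u = 0" "m' \<bullet> v = 0" "m' \<bullet> n = 0"
    using sym_endo_eigenvectors_orthogonal[OF \<delta> mu'] nu by blast+
  have "w' = cos \<alpha>' *\<^sub>R n' + sin \<alpha>' *\<^sub>R m'"
  proof -
    have "cos \<alpha>' *\<^sub>R n' + sin \<alpha>' *\<^sub>R m' = (cos \<alpha>' * cos \<alpha>' + sin \<alpha>' * sin \<alpha>') *\<^sub>R w'"
      unfolding n'_def m'_def by (simp add: algebra_simps del: sin_cos_squared_add3)
    then show ?thesis by simp
  qed
  then have w'N: "w' \<bullet> u = cos \<alpha>' * (n' \<bullet> u)" "w' \<bullet> v = cos \<alpha>' * (n' \<bullet> v)" "w' \<bullet> n = cos \<alpha>' * (n' \<bullet> n)"
    using m'N by (simp_all add: inner_add_left)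
  define a b c p q r where "a = u' \<bullet> u" and "b = u' \<bullet> v" and "c = u' \<bullet> n"
    and "p = v' \<bullet> u" and "q = v' \<bullet> v" and "r = v' \<bullet> n"
  note gen' = cayley_inner_generators[OF t' w'_def]
  have lengths: "a * a + b * b + c * c = 1" "p * p + q * q + r * r = 1" "a * p + b * q + c * r = 0"
    using parseval[OF nu'(1), of u'] parseval[OF nu'(2), of v'] parseval[OF nu'(1), of v'] gen'
    by (simp_all add: a_def b_def c_def p_def q_def r_def)
  have "w' \<bullet> u = cos \<alpha> * (b * r - c * q)" "w' \<bullet> v = cos \<alpha> * (c * p - a * r)" "w' \<bullet> n = cos \<alpha> * (a * q - b * p)"
    using plane_normal_vprod_inner(2-4)[OF dim7 t w_def n_def m_def refl expand[OF nu'(1)] expand[OF nu'(2)]]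
    by (simp_all add: w'_def a_def b_def c_def p_def q_def r_def)
  then have "(w' \<bullet> u)\<^sup>2 + (w' \<bullet> v)\<^sup>2 + (w' \<bullet> n)\<^sup>2 =
      (cos \<alpha>)\<^sup>2 * ((b * r - c * q)\<^sup>2 + (c * p - a * r)\<^sup>2 + (a * q - b * p)\<^sup>2)"
    by (simp add: power_mult_distrib distrib_left)
  also have "(b * r - c * q)\<^sup>2 + (c * p - a * r)\<^sup>2 + (a * q - b * p)\<^sup>2 =
      (a * a + b * b + c * c) * (p * p + q * q + r * r) - (a * p + b * q + c * r)\<^sup>2"
    by (simp add: power2_eq_square algebra_simps)
  finally have "(w' \<bullet> u)\<^sup>2 + (w' \<bullet> v)\<^sup>2 + (w' \<bullet> n)\<^sup>2 = (cos \<alpha>)\<^sup>2"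
    using lengths by simp
  moreover have "(w' \<bullet> u)\<^sup>2 + (w' \<bullet> v)\<^sup>2 + (w' \<bullet> n)\<^sup>2 = (cos \<alpha>')\<^sup>2 * (n' \<bullet> n')"
    unfolding w'N parseval[OF nu'(3), of n'] by (simp add: power2_eq_square algebra_simps)
  ultimately show ?thesis
    using plane_normal_inner(1)[OF frame'] by simp
qed

text \<open>Both vectors are orthogonal to the same eigenspace and to all its products.\<close>

lemma eigenframe_normal_unique:
  assumes "sin \<alpha> \<noteq> 0"
  shows "(u' \<star> v') \<star> z' = (u \<star> v) \<star> z \<or> (u' \<star> v') \<star> z' = - ((u \<star> v) \<star> z)"
proof -
  define w n where "w = u \<star> v" and "n = cos \<alpha> *\<^sub>R w - sin \<alpha> *\<^sub>R z"
  define w' n' where "w' = u' \<star> v'" and "n' = cos \<alpha>' *\<^sub>R w' - sin \<alpha>' *\<^sub>R z'"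
  note frame' = dim7 t' w'_def n'_def refl refl
  have nu: "\<delta> u = \<nu> *\<^sub>R u" "\<delta> v = \<nu> *\<^sub>R v" "\<delta> n = \<nu> *\<^sub>R n"
    using eig[of 1] eig[of 2] eig[of 3] by (simp_all add: eigenframe_nth d n_def w_def)
  have expand: "x = (x \<bullet> u') *\<^sub>R u' + (x \<bullet> v') *\<^sub>R v' + (x \<bullet> n') *\<^sub>R n'" if "\<delta> x = \<nu> *\<^sub>R x" for x
    by (rule eigenframe_nu_expand[OF t' _ eig' that]) (simp add: n'_def w'_def)
  have N: "(w' \<star> z') \<bullet> x = 0" if "\<delta> x = \<nu> *\<^sub>R x" for x
    by (subst expand[OF that]) (simp add: inner_add_right plane_normal_inner(13-15)[OF frame'])
  have NN: "(w' \<star> z') \<bullet> (x \<star> y) = 0" if "\<delta> x = \<nu> *\<^sub>R x" "\<delta> y = \<nu> *\<^sub>R y" for x y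
    using plane_normal_vprod_inner(1)[OF frame' expand[OF that(1)] expand[OF that(2)]]
    by (simp add: inner_commute)
  have "w' \<star> z' = w \<star> z \<or> w' \<star> z' = - (w \<star> z)"
  proof (rule plane_normal_unique[OF dim7 t w_def n_def refl refl assms])
    show "(w' \<star> z') \<bullet> (w' \<star> z') = 1" by (rule plane_normal_inner(12)[OF frame'])
    show "(w' \<star> z') \<bullet> w = 0" unfolding w_def by (rule NN[OF nu(1,2)])
  qed (intro N NN nu)+
  then show ?thesis by (simp only: w_def w'_def)
qed

lemma eigenframe_parameters_unique:
  assumes "(\<alpha>, \<theta>, \<phi>) \<in> ({0<..pi/2} \<times> {0..pi/2} \<times> {0<..pi/2}) \<union> ({0<..pi/2} \<times> {(0, 0)}) \<union> {(0, 0, 0)}"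
    and "(\<alpha>', \<theta>', \<phi>') \<in> ({0<..pi/2} \<times> {0..pi/2} \<times> {0<..pi/2}) \<union> ({0<..pi/2} \<times> {(0, 0)}) \<union> {(0, 0, 0)}"
  shows "\<alpha> = \<alpha>' \<and> \<theta> = \<theta>' \<and> \<phi> = \<phi>'"
proof -
  have range: "0 \<le> \<alpha>" "\<alpha> \<le> pi / 2" "0 \<le> \<theta>" "\<theta> \<le> pi / 2" "0 \<le> \<phi>" "\<phi> \<le> pi / 2"
    and range': "0 \<le> \<alpha>'" "\<alpha>' \<le> pi / 2" "0 \<le> \<theta>'" "\<theta>' \<le> pi / 2" "0 \<le> \<phi>'" "\<phi>' \<le> pi / 2"
    and zero: "\<alpha> = 0 \<Longrightarrow> \<theta> = 0 \<and> \<phi> = 0" "\<alpha>' = 0 \<Longrightarrow> \<theta>' = 0 \<and> \<phi>' = 0"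
      "\<phi> = 0 \<Longrightarrow> \<theta> = 0" "\<phi>' = 0 \<Longrightarrow> \<theta>' = 0"
    using assms pi_ge_zero by auto
  have cos_inj: "x = y" if "0 \<le> x" "x \<le> pi / 2" "0 \<le> y" "y \<le> pi / 2" "\<bar>cos x\<bar> = \<bar>cos y\<bar>" for x y
  proof -
    have "0 \<le> cos x" "0 \<le> cos y" using that by (intro cos_ge_zero; linarith)+
    then have "cos x = cos y" using that(5) by simp
    moreover have "x \<le> pi" "y \<le> pi" using that pi_gt_zero by linarith+
    ultimately show ?thesis using cos_inj_pi[of x y] that(1,3) by blast
  qed
  have \<alpha>: "\<alpha> = \<alpha>'"
    using eigenframe_cos_square_unique
    by (intro cos_inj[OF range(1,2) range'(1,2)]) (simp add: power2_eq_iff abs_eq_iff)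
  show ?thesis
  proof (cases "\<alpha> = 0")
    case True
    then show ?thesis using \<alpha> zero by auto
  next
    case False
    then have "0 < sin \<alpha>" using range pi_gt_zero by (intro sin_gt_zero) linarith+
    then have f: "(u' \<star> v') \<star> z' = (u \<star> v) \<star> z \<or> (u' \<star> v') \<star> z' = - ((u \<star> v) \<star> z)"
      using eigenframe_normal_unique by auto
    have inner: "\<bar>eigenframe (u', v', z') \<alpha>' \<theta>' \<phi>' $ j \<bullet> ((u' \<star> v') \<star> z')\<bar> =
        \<bar>eigenframe (u, v, z) \<alpha> \<theta> \<phi> $ j \<bullet> ((u \<star> v) \<star> z)\<bar>" if "{i. d $ i = d $ j} = {j}" for j
      using eigenframe_line_unique[OF t t' eig eig' that] f by auto
    have ff: "eigenframe (u, v, z) \<alpha> \<theta> \<phi> $ 7 \<bullet> ((u \<star> v) \<star> z) = cos \<phi>"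
      "eigenframe (u, v, z) \<alpha> \<theta> \<phi> $ 6 \<bullet> ((u \<star> v) \<star> z) = - (sin \<phi> * cos \<theta>)"
      if "cayley_triple (\<star>) (u, v, z)" for u v z \<alpha> \<theta> \<phi>
      unfolding eigenframe_nth using cayley_inner_generators[OF that refl]
      by (simp_all add: inner_add_left inner_diff_left cayley_inner_products[OF that refl])
    have "{i. d $ i = d $ 7} = {7}" "{i. d $ i = d $ 6} = {6}"
      unfolding set_eq_iff forall_7 using distinct by (auto simp: d)
    note lines = this[THEN inner, unfolded ff[OF t] ff[OF t']]
    have \<phi>: "\<phi> = \<phi>'"
      using lines(1) by (rule cos_inj[OF range(5,6) range'(5,6), OF sym])
    show ?thesis
    proof (cases "\<phi> = 0")
      case True
      then show ?thesis using \<alpha> \<phi> zero by auto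
    next
      case False
      then have "0 < sin \<phi>" using range pi_gt_zero by (intro sin_gt_zero) linarith+
      then have "\<theta> = \<theta>'"
        using lines(2) \<phi> by (intro cos_inj[OF range(3,4) range'(3,4)]) (simp add: abs_mult)
      then show ?thesis using \<alpha> \<phi> by simp
    qed
  qed
qed

end

end

end

section \<open>The cross-section\<close>

lemma dim_eigenspace_of_spectral_data:
  "(l, k) \<in> spectral_data M \<Longrightarrow> dim (eigenspace M l) = k"
  by (auto simp: spectral_data_def)

theorem proposition3p8:
  fixes \<pi> :: "'v::euclidean_space \<Rightarrow> 'v \<Rightarrow> 'v" and s :: "'v \<times> 'v \<times> 'v"
    and \<kappa> lam \<mu> \<nu> :: real
  assumes "DIM('v) = 7" and "vector_product \<pi>" and "cayley_triple \<pi> s"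
    and "distinct [\<kappa>, lam, \<mu>, \<nu>]"
  shows "cross_section \<pi> s (sym_mat_of {(\<kappa>, 1), (lam, 1), (\<mu>, 2), (\<nu>, 3)})
    {block_diag (\<nu> *\<^sub>R mat 1)
       (matrix_inv (Rot \<alpha>) ** diag2 \<nu> \<mu> ** Rot \<alpha>)
       (matrix_inv (SRot \<theta> \<phi>) ** diag3 \<mu> lam \<kappa> ** SRot \<theta> \<phi>) | \<alpha> \<theta> \<phi>.
     (\<alpha>, \<theta>, \<phi>) \<in> ({0<..pi/2} \<times> {0..pi/2} \<times> {0<..pi/2})
       \<union> ({0<..pi/2} \<times> {(0, 0)}) \<union> {(0, 0, 0)}}"
proof -
  interpret cross_product \<pi> by unfold_locales (rule assms(2))
  define d :: "real^7" where "d = vector [\<nu>, \<nu>, \<nu>, \<mu>, \<mu>, lam, \<kappa>]"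
  define R where "R = ({0<..pi/2} \<times> {0..pi/2} \<times> {0<..pi/2}) \<union> ({0<..pi/2} \<times> {(0, 0)}) \<union> {(0, 0, 0 :: real)}"
  define normal where "normal \<alpha> \<theta> \<phi> = transpose (frame \<alpha> \<theta> \<phi>) ** diagonal_matrix d ** frame \<alpha> \<theta> \<phi>"
    for \<alpha> \<theta> \<phi>
  let ?p = "{(\<kappa>, 1), (lam, 1), (\<mu>, 2), (\<nu>, 3)} :: (real \<times> nat) set"
  let ?b = "cayley_basis \<pi> s"
  have card: "DIM('v) = CARD(7)" using assms(1) by simp
  note b = cayley_basis_orthonormal[OF assms(3)]
  have "normal \<alpha> \<theta> \<phi> \<in> sym_mat_of ?p" for \<alpha> \<theta> \<phi>
    using spectral_data_normal_form[OF assms(4) orthogonal_matrix_frame, of \<alpha> \<theta> \<phi>]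
    by (simp add: normal_def sym_mat_of_def sym_mat_def transpose_diagonalized d_def)
  moreover have "\<exists>!N. (\<exists>\<alpha> \<theta> \<phi>. N = normal \<alpha> \<theta> \<phi> \<and> (\<alpha>, \<theta>, \<phi>) \<in> R) \<and> N \<in> mat_orbit \<pi> s M"
    if M: "M \<in> sym_mat_of ?p" for M
  proof -
    define \<delta> where "\<delta> = endo_of ?b M"
    have sym: "\<delta> \<in> sym_endo" and \<delta>M: "matrix_wrt ?b \<delta> = M"
      using M endo_of_sym_endo[OF b card] matrix_wrt_endo_of[OF b card]
      by (auto simp: \<delta>_def sym_mat_of_def)
    then have lin: "linear \<delta>" unfolding sym_endo_def by blast
    have "spectral_data M = ?p" using M by (simp add: sym_mat_of_def)
    then have dims: "dim {x. \<delta> x = \<kappa> *\<^sub>R x} = 1" "dim {x. \<delta> x = lam *\<^sub>R x} = 1"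
      "dim {x. \<delta> x = \<mu> *\<^sub>R x} = 2" "dim {x. \<delta> x = \<nu> *\<^sub>R x} = 3"
      unfolding \<delta>_def dim_endo_of_eigenspace[OF b card]
      by (auto intro!: dim_eigenspace_of_spectral_data)
    have orbit: "mat_orbit \<pi> s M = {matrix_wrt (cayley_basis \<pi> t) \<delta> | t. cayley_triple \<pi> t}"
      using mat_orbit_eq[OF assms(1,3) sym] \<delta>M by simp
    have normal_iff: "matrix_wrt (cayley_basis \<pi> t) \<delta> = normal \<alpha> \<theta> \<phi> \<longleftrightarrow>
        (\<forall>i. \<delta> (eigenframe t \<alpha> \<theta> \<phi> $ i) = d $ i *\<^sub>R eigenframe t \<alpha> \<theta> \<phi> $ i)"
      if "cayley_triple \<pi> t" for t \<alpha> \<theta> \<phi>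
      unfolding normal_def by (rule matrix_wrt_normal_form_iff[OF assms(1) that lin])
    obtain t \<alpha> \<theta> \<phi> where t: "cayley_triple \<pi> t" and R: "(\<alpha>, \<theta>, \<phi>) \<in> R"
      and eig: "\<forall>i. \<delta> (eigenframe t \<alpha> \<theta> \<phi> $ i) = d $ i *\<^sub>R eigenframe t \<alpha> \<theta> \<phi> $ i"
      using eigenframe_exists[OF assms(1) sym assms(4) dims d_def] unfolding R_def by blast
    have normal_eq: "normal \<alpha> \<theta> \<phi> = matrix_wrt (cayley_basis \<pi> t) \<delta>"
      using normal_iff[OF t] eig by metis
    show ?thesis
    proof (rule ex1I[of _ "normal \<alpha> \<theta> \<phi>"])
      show "(\<exists>\<alpha>' \<theta>' \<phi>'. normal \<alpha> \<theta> \<phi> = normal \<alpha>' \<theta>' \<phi>' \<and> (\<alpha>', \<theta>', \<phi>') \<in> R) \<and>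
          normal \<alpha> \<theta> \<phi> \<in> mat_orbit \<pi> s M"
        using R normal_eq t unfolding orbit by blast
    next
      fix N assume "(\<exists>\<alpha>' \<theta>' \<phi>'. N = normal \<alpha>' \<theta>' \<phi>' \<and> (\<alpha>', \<theta>', \<phi>') \<in> R) \<and> N \<in> mat_orbit \<pi> s M"
      then obtain \<alpha>' \<theta>' \<phi>' t' where N: "N = normal \<alpha>' \<theta>' \<phi>'" and R': "(\<alpha>', \<theta>', \<phi>') \<in> R"
        and t': "cayley_triple \<pi> t'" and "N = matrix_wrt (cayley_basis \<pi> t') \<delta>"
        unfolding orbit by blast
      then have eig': "\<forall>i. \<delta> (eigenframe t' \<alpha>' \<theta>' \<phi>' $ i) = d $ i *\<^sub>R eigenframe t' \<alpha>' \<theta>' \<phi>' $ i"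
        using normal_iff by simp
      obtain u v z u' v' z' where uvz: "t = (u, v, z)" "t' = (u', v', z')"
        by (metis prod_cases3)
      have "\<alpha> = \<alpha>' \<and> \<theta> = \<theta>' \<and> \<phi> = \<phi>'"
        using eig eig' t t' R R' unfolding uvz R_def
        by (intro eigenframe_parameters_unique[OF assms(1) sym assms(4) d_def]) blast+
      then show "N = normal \<alpha> \<theta> \<phi>" using N by simp
    qed
  qed
  ultimately show ?thesis
    unfolding cross_section_def normal_form_eq d_def[symmetric] normal_def[symmetric] R_def[symmetric]
    by auto
qed

end
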